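(* Let $\mathfrak{b}:[0,\infty)\times\mathbb{R}\times\mathcal{I}\to\mathbb{R}$ be a bounded measurable function, assume the Barrow–Osgood conditions $H_{x_0}(\ell+)=-\infty$, $H_{x_0}(r-)=\infty$, and assume that for each given $n\in\mathbb{N}$ the following conditions hold: (i) the function $\mathbb{R}\ni w\mapsto\mathfrak{b}(t,w,\xi)$ is continuous for all $(t,\xi)\in[0,\infty)\times\mathcal{I}$; and (ii) for all $(t,w,\xi_1,\xi_2)\in[0,n]\times[-n,n]\times(\ell_n,r_n)^2$, $$|\mathfrak{b}(t,w,\xi_1)-\mathfrak{b}(t,w,\xi_2)|\le L_n\,|\xi_1-\xi_2|,$$ where the constant $L_n<\infty$ depends only on the integer $n$. Then the following statements hold. 1. For each path $\omega\in C([0,\infty);\mathbb{R})$ the ordinary integral equation $$\Gamma(T)=\int_0^T\mathfrak{b}\big(t,\omega(t),\Theta_{x_0}(\Gamma(t)+\omega(t))\big)\,\mathrm{d}t,\qquad 0\le T<\infty,$$ has a unique solution $\Gamma_\omega(\cdot)$. This solution is progressively measurable and satisfies $\Gamma_\omega(\cdot)\in\mathbb{R}$. 2. If $\{\omega_k(\cdot)\}_{k\in\mathbb{N}}$ is a sequence of continuous paths in $C([0,\infty);\mathbb{R})$ such that $$\lim_{k\uparrow\infty}\ \sup_{t\in[0,n]}|\omega(t)-\omega_k(t)|=0,\qquad n\in\mathbb{N},$$ holds for some $\omega(\cdot)\in C([0,\infty);\mathbb{R})$, then with $\mathbf{x}(\cdot):=\Theta_{x_0}(\Gamma_\omega(\cdot)+\omega(\cdot))$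 and $\mathbf{x}_k(\cdot):=\Theta_{x_0}(\Gamma_{\omega_k}(\cdot)+\omega_k(\cdot))$ we have $$\lim_{k\uparrow\infty}\ \sup_{t\in[0,n]}|\mathbf{x}(t)-\mathbf{x}_k(t)|=0,\qquad n\in\mathbb{N}.$$ In particular, the "input-output mapping" $\omega\mapsto\Theta_{x_0}(\Gamma_\omega(\cdot)+\omega(\cdot))\equiv\mathfrak{X}(\cdot,\omega)$ is continuous as a function from $C([0,\infty);\mathbb{R})$ into $C([0,\infty);\mathcal{I})$, where both spaces are equipped with the topology of uniform convergence on compact subsets.
   Context: $\mathcal{I}=(\ell,r)$ is a fixed open interval of the real line, $x_0\in\mathcal{I}$, and $\{\ell_n\}$, $\{r_n\}$ are fixed sequences with $\ell<\ell_{n+1}<\ell_n<x_0<r_n<r_{n+1}<r$ for all $n$, $\ell_n\downarrow\ell$, $r_n\uparrow r$. $\mathfrak{s}:\mathcal{I}\to(0,\infty)$ is a fixed measurable function such that $\log\mathfrak{s}$ is left-continuous and of finite first variation on compact subsets of $\mathcal{I}$. $H_{x_0}(x)=\int_{x_0}^x\frac{\mathrm{d}z}{\mathfrak{s}(z)}$ for $x\in\mathcal{I}$ (with $\int_{x_0}^x=-\int_x^{x_0}$ if $x<x_0$), and $\Theta_{x_0}$ is the inverse function of $H_{x_0}$; under the Barrow–Osgood conditions $\Theta_{x_0}$ is defined on all of $\mathbb{R}$ with values in $\mathcal{I}$. Progressive measurability of $\Gamma$ means: for each $t\ge0$ the restriction of $(s,\omega)\mapsto\Gamma_\omega(s)$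 to $[0,t]\times C([0,\infty);\mathbb{R})$ is $\mathcal{B}([0,t])\otimes\mathcal{F}^W(t)$-measurable, where $\mathcal{F}^W(t)=\sigma(W(s),0\le s\le t)$ and $W(t,\omega)=\omega(t)$ is the coordinate process on $C([0,\infty);\mathbb{R})$. *)

theory Defs
  imports "HOL-Analysis.Analysis"
begin

definition finite_variation_on :: "real set \<Rightarrow> (real \<Rightarrow> real) \<Rightarrow> bool" where
  "finite_variation_on K f \<longleftrightarrow>
     (\<exists>B. \<forall>(N::nat) x. (\<forall>i\<le>N. x i \<in> K) \<and> (\<forall>i<N. x i \<le> x (Suc i)) \<longrightarrow>
        (\<Sum>i<N. \<bar>f (x (Suc i)) - f (x i)\<bar>) \<le> B)"

text \<open>The interval integral is oriented, so the sign convention for \<open>x < x0\<close> is built in.\<close>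

definition H_fun :: "(real \<Rightarrow> real) \<Rightarrow> real \<Rightarrow> real \<Rightarrow> real" where
  "H_fun s x0 x = (LBINT z=ereal x0..ereal x. 1 / s z)"

definition Theta :: "ereal \<Rightarrow> ereal \<Rightarrow> (real \<Rightarrow> real) \<Rightarrow> real \<Rightarrow> real \<Rightarrow> real" where
  "Theta l r s x0 = the_inv_into (einterval l r) (H_fun s x0)"

text \<open>The space \<open>C([0,\<infinity>); S)\<close>. Paths are total functions, made extensional
  (constantly \<open>undefined\<close> on the negative reals) so that they are determined by their
  values on \<open>[0,\<infinity>)\<close>.\<close>

definition cpaths :: "real set \<Rightarrow> (real \<Rightarrow> real) set" where
  "cpaths S = {f \<in> {0..} \<rightarrow>\<^sub>E S. continuous_on {0..} f}"

text \<open>The topology of uniform convergence on compact sets. By compactness each of the generating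
  sets contains, around each of its points, a set of the same form with the same \<open>K\<close>;
  they form a base, and those centred at \<open>f\<close> are a neighbourhood base at \<open>f\<close>.\<close>

definition ucc_topology :: "real set \<Rightarrow> (real \<Rightarrow> real) topology" where
  "ucc_topology S = topology_generated_by
     {{g \<in> cpaths S. \<forall>t\<in>K. dist (f t) (g t) < e} | f K e.
        f \<in> cpaths S \<and> compact K \<and> K \<subseteq> {0..} \<and> 0 < e}"

lemma topspace_ucc_topology: "topspace (ucc_topology S) = cpaths S"
proof -
  have "f \<in> \<Union>{{g \<in> cpaths S. \<forall>t\<in>K. dist (f t) (g t) < e} | f K e.
        f \<in> cpaths S \<and> compact K \<and> K \<subseteq> {0..} \<and> 0 < e}" if "f \<in> cpaths S" for f
    using that by (intro UnionI[of "{g \<in> cpaths S. \<forall>t\<in>{}. dist (f t) (g t) < 1}"] CollectI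
        exI[of _ f] exI[of _ "{}"] exI[of _ 1]) auto
  then show ?thesis
    unfolding ucc_topology_def topology_generated_by_topspace by blast
qed

text \<open>The natural filtration \<open>\<sigma>(W(s), 0 \<le> s \<le> t)\<close> of the coordinate process on
  \<open>C([0,\<infinity>); \<real>)\<close>.\<close>

definition coord_filtration :: "real \<Rightarrow> (real \<Rightarrow> real) measure" where
  "coord_filtration t =
     sigma (cpaths UNIV)
       {(\<lambda>\<omega>. \<omega> s) -` A \<inter> cpaths UNIV | s A. s \<in> {0..t} \<and> A \<in> sets borel}"

definition progressively_measurable :: "(real \<Rightarrow> 'w measure) \<Rightarrow> ('w \<Rightarrow> real \<Rightarrow> real) \<Rightarrow> bool" where
  "progressively_measurable F X \<longleftrightarrow>
     (\<forall>t\<ge>0. (\<lambda>(s, \<omega>). X \<omega> s) \<in> borel_measurable (restrict_space borel {0..t} \<Otimes>\<^sub>M F t))"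

text \<open>Integrability is part of being a solution, as the Bochner integral of a non-integrable
  function is \<open>0\<close> by convention. Solutions are extensional on \<open>[0,\<infinity>)\<close>, as in
  \<open>cpaths\<close>, so that uniqueness concerns values on \<open>[0,\<infinity>)\<close> only; no regularity
  of \<open>\<Gamma>\<close> is presupposed.\<close>

definition solves_integral_eq ::
  "(real \<Rightarrow> real \<Rightarrow> real \<Rightarrow> real) \<Rightarrow> (real \<Rightarrow> real) \<Rightarrow> (real \<Rightarrow> real) \<Rightarrow> (real \<Rightarrow> real) \<Rightarrow> bool" where
  "solves_integral_eq b \<Theta> \<omega> \<Gamma> \<longleftrightarrow> \<Gamma> \<in> extensional {0..} \<and>
     (\<forall>T\<ge>0.
        interval_lebesgue_integrable lborel 0 (ereal T) (\<lambda>t. b t (\<omega> t) (\<Theta> (\<Gamma> t + \<omega> t))) \<and>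
        \<Gamma> T = (LBINT t=0..ereal T. b t (\<omega> t) (\<Theta> (\<Gamma> t + \<omega> t))))"

definition Gamma_sol ::
  "(real \<Rightarrow> real \<Rightarrow> real \<Rightarrow> real) \<Rightarrow> (real \<Rightarrow> real) \<Rightarrow> (real \<Rightarrow> real) \<Rightarrow> real \<Rightarrow> real" where
  "Gamma_sol b \<Theta> \<omega> = (THE \<Gamma>. solves_integral_eq b \<Theta> \<omega> \<Gamma>)"

definition input_output ::
  "(real \<Rightarrow> real \<Rightarrow> real \<Rightarrow> real) \<Rightarrow> (real \<Rightarrow> real) \<Rightarrow> (real \<Rightarrow> real) \<Rightarrow> real \<Rightarrow> real" where
  "input_output b \<Theta> \<omega> = (\<lambda>t\<in>{0..}. \<Theta> (Gamma_sol b \<Theta> \<omega> t + \<omega> t))"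

end

theory Submission
  imports Defs
begin

text \<open>Finite variation of \<open>ln s\<close> on compact intervals bounds \<open>s\<close> there away from \<open>0\<close> and
  \<open>\<infinity>\<close>, so \<open>H_fun s x0\<close> is locally bi-Lipschitz; by the Barrow--Osgood conditions it maps the
  interval onto \<open>\<real>\<close>, and \<open>\<Theta>\<close> is locally Lipschitz. Hence \<open>c t w y = b t w (\<Theta> y)\<close> is bounded
  and locally Lipschitz in \<open>y\<close>. As \<open>c\<close> is bounded, solutions on \<open>[0, T]\<close> stay in a fixed compact
  set, and Picard iteration converges, with distances weighted by \<open>exp (- 2 * K * t)\<close>. The
  iterates are jointly measurable in time and path, hence so is their limit. Stability follows from
  Gronwall's inequality, where continuity of \<open>b\<close> in \<open>w\<close> enters through dominated convergence.\<close>

section \<open>Caratheodory equations driven by a path\<close>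

text \<open>Two features of the hypotheses shape the estimates. Lipschitz constants exist only on
  bounded boxes, so a box must be found before a constant is chosen; the bound \<open>B * T\<close>
  on [0, T] depends neither on the path nor on the iterate, so one constant serves all iterates, and
  also a whole sequence of nearby paths. Continuity in w comes for each fixed time and state without
  a modulus, so closeness of two paths gives no rate for the difference of the fields; that
  difference is taken at the limiting state and is small only after integration in time. Composition
  with \<open>\<Theta>\<close> makes the state space the whole line, so the equation itself never
  meets the endpoints of the interval. The solution is constructed as a pointwise limit, since
  uniqueness alone says nothing about measurability in the path.\<close>

lemma continuous_on_bounded_abs:
  fixes f :: "real \<Rightarrow> real"
  assumes "continuous_on {0..} f"
  obtains M where "0 \<le> M" "\<And>t. t \<in> {0..T} \<Longrightarrow> \<bar>f t\<bar> \<le> M"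
proof -
  have "bounded (f ` {0..T})"
    by (intro compact_imp_bounded compact_continuous_image continuous_on_subset[OF assms]) auto
  then obtain M where "0 < M" "\<forall>x\<in>f ` {0..T}. norm x \<le> M"
    unfolding bounded_pos by blast
  then show thesis
    by (intro that[of M]) auto
qed

lemma set_integrable_continuous_Icc:
  "continuous_on {0..T} f \<Longrightarrow> set_integrable lborel {0..T::real} (f :: real \<Rightarrow> real)"
  by (rule borel_integrable_atLeastAtMost')

lemma set_integral_exp:
  fixes K T :: real
  assumes "0 \<le> T" "0 < K"
  shows "(LBINT t:{0..T}. exp (2 * K * t)) = (exp (2 * K * T) - 1) / (2 * K)"
proof -
  have "(LBINT t:{0..T}. exp (2 * K * t)) = exp (2 * K * T) / (2 * K) - exp (2 * K * 0) / (2 * K)"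
    unfolding set_lebesgue_integral_def using assms
    by (intro integral_FTC_atLeastAtMost)
       (auto intro!: derivative_eq_intros continuous_intros
         simp flip: has_real_derivative_iff_has_vector_derivative)
  then show ?thesis by (simp add: diff_divide_distrib)
qed

text \<open>The maximum of \<open>D t * exp (- 2 * K * t)\<close> controls itself up to a factor \<open>1 / 2\<close>.\<close>

lemma gronwall:
  fixes D :: "real \<Rightarrow> real"
  assumes cont: "continuous_on {0..T} D" and "0 < K" "0 \<le> \<epsilon>"
    and D: "\<And>t. t \<in> {0..T} \<Longrightarrow> D t \<le> \<epsilon> + K * (LBINT s:{0..t}. D s)"
    and t: "t \<in> {0..T}"
  shows "D t \<le> 2 * \<epsilon> * exp (2 * K * t)"
proof -
  obtain u where u: "u \<in> {0..T}"
    and max: "\<And>s. s \<in> {0..T} \<Longrightarrow> D s * exp (- (2 * K * s)) \<le> D u * exp (- (2 * K * u))"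
  proof -
    have "continuous_on {0..T} (\<lambda>s. D s * exp (- (2 * K * s)))"
      by (intro continuous_intros cont)
    then show thesis
      using continuous_attains_sup[of "{0..T}" "\<lambda>s. D s * exp (- (2 * K * s))"] t that by fastforce
  qed
  define A where "A = D u * exp (- (2 * K * u))"
  have D_le: "D s \<le> A * exp (2 * K * s)" if "s \<in> {0..T}" for s
    using max[OF that] by (simp add: A_def exp_minus field_simps)
  \<comment> \<open>D carries no sign assumption, so A may be nonpositive; in the other case A > 0
    allows the exponential to be dropped at the end.\<close>
  have "A \<le> 2 * \<epsilon>"
  proof (cases "A \<le> 0")
    case False
    have "(LBINT s:{0..u}. D s) \<le> (LBINT s:{0..u}. A * exp (2 * K * s))"
      using u by (intro set_integral_mono D_le set_integrable_continuous_Icc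
          continuous_on_subset[OF cont] continuous_intros) auto
    also have "\<dots> = A * ((exp (2 * K * u) - 1) / (2 * K))"
      using u \<open>0 < K\<close> by (simp add: set_integral_exp)
    finally have "D u \<le> \<epsilon> + K * (A * ((exp (2 * K * u) - 1) / (2 * K)))"
      using D[OF u] \<open>0 < K\<close> by (smt (verit) mult_left_mono)
    also have "\<dots> = \<epsilon> + A * (exp (2 * K * u) - 1) / 2"
      using \<open>0 < K\<close> by simp
    finally have "A * exp (2 * K * u) \<le> \<epsilon> + A * (exp (2 * K * u) - 1) / 2"
      using D_le[OF u] by (simp add: A_def exp_minus field_simps)
    then have "A * (exp (2 * K * u) + 1) \<le> 2 * \<epsilon>"
      by (simp add: field_simps)
    moreover have "A * 1 \<le> A * (exp (2 * K * u) + 1)"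
      using False by (intro mult_left_mono) auto
    ultimately show ?thesis by simp
  qed (use \<open>0 \<le> \<epsilon>\<close> in simp)
  then show ?thesis
    using D_le[OF t] by (smt (verit) exp_gt_zero mult_right_mono)
qed

text \<open>The requirements are on total functions of three real variables, negative times
  included, so that no domain conditions on the state arise. A single integer bounds time, path and
  state at once.\<close>

locale integral_equation =
  fixes c :: "real \<Rightarrow> real \<Rightarrow> real \<Rightarrow> real" and B :: real
  assumes meas: "(\<lambda>(t, w, y). c t w y) \<in> borel_measurable borel"
    and bound: "\<And>t w y. \<bar>c t w y\<bar> \<le> B"
    and cont: "\<And>t y. continuous_on UNIV (\<lambda>w. c t w y)"
    and lip: "\<And>n::nat. \<exists>K. \<forall>t\<in>{0..real n}. \<forall>w\<in>{-real n..real n}. \<forall>y1\<in>{-real n..real n}.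
      \<forall>y2\<in>{-real n..real n}. \<bar>c t w y1 - c t w y2\<bar> \<le> K * \<bar>y1 - y2\<bar>"
begin

lemma B_nonneg: "0 \<le> B"
  using bound[of 0 0 0] by linarith

lemma measurable_field [measurable (raw)]:
  assumes [measurable]: "f \<in> borel_measurable M" "g \<in> borel_measurable M" "h \<in> borel_measurable M"
  shows "(\<lambda>x. c (f x) (g x) (h x)) \<in> borel_measurable M"
proof -
  have "(\<lambda>x. (f x, g x, h x)) \<in> M \<rightarrow>\<^sub>M borel"
    by (simp flip: borel_prod)
  from measurable_compose[OF this meas] show ?thesis by simp
qed

lemma locally_lipschitz:
  obtains K where "0 < K" "\<And>t w y1 y2. t \<in> {0..T} \<Longrightarrow> \<bar>w\<bar> \<le> M \<Longrightarrow> \<bar>y1\<bar> \<le> M \<Longrightarrow> \<bar>y2\<bar> \<le> M \<Longrightarrow>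
    \<bar>c t w y1 - c t w y2\<bar> \<le> K * \<bar>y1 - y2\<bar>"
proof -
  obtain n :: nat where n: "max T M \<le> real n"
    using real_arch_simple by blast
  obtain K where K: "\<forall>t\<in>{0..real n}. \<forall>w\<in>{-real n..real n}. \<forall>y1\<in>{-real n..real n}.
      \<forall>y2\<in>{-real n..real n}. \<bar>c t w y1 - c t w y2\<bar> \<le> K * \<bar>y1 - y2\<bar>"
    using lip by blast
  show thesis
  proof
    fix t w y1 y2 assume "t \<in> {0..T}" "\<bar>w\<bar> \<le> M" "\<bar>y1\<bar> \<le> M" "\<bar>y2\<bar> \<le> M"
    then have "\<bar>c t w y1 - c t w y2\<bar> \<le> K * \<bar>y1 - y2\<bar>"
      using n by (intro K[rule_format]) auto
    also have "\<dots> \<le> max K 1 * \<bar>y1 - y2\<bar>"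
      by (intro mult_right_mono) auto
    finally show "\<bar>c t w y1 - c t w y2\<bar> \<le> max K 1 * \<bar>y1 - y2\<bar>" .
  qed auto
qed

text \<open>A convergent sequence and its limit lie in one bounded box, where the Lipschitz estimate
  applies. This is what lets the iterates pass to the limit inside the field.\<close>

lemma field_continuous_state: "0 \<le> t \<Longrightarrow> continuous_on UNIV (c t w)"
  unfolding continuous_on_sequentially
proof safe
  fix x :: "nat \<Rightarrow> real" and y assume t: "0 \<le> t" and lim: "x \<longlonglongrightarrow> y"
  then have "Bseq x"
    by (intro convergent_imp_Bseq) (auto simp: convergent_def)
  then obtain M where M: "\<And>n. \<bar>x n\<bar> \<le> M"
    unfolding Bseq_def by auto
  obtain K where K: "0 < K" "\<And>t' w' y1 y2. t' \<in> {0..t} \<Longrightarrow> \<bar>w'\<bar> \<le> max M (max \<bar>w\<bar> \<bar>y\<bar>) \<Longrightarrow>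
    \<bar>y1\<bar> \<le> max M (max \<bar>w\<bar> \<bar>y\<bar>) \<Longrightarrow> \<bar>y2\<bar> \<le> max M (max \<bar>w\<bar> \<bar>y\<bar>) \<Longrightarrow>
    \<bar>c t' w' y1 - c t' w' y2\<bar> \<le> K * \<bar>y1 - y2\<bar>"
    using locally_lipschitz by blast
  have le: "norm (c t w (x n) - c t w y) \<le> K * \<bar>x n - y\<bar>" for n
    unfolding real_norm_def using M[of n] t by (intro K(2)) auto
  have "(\<lambda>n. K * \<bar>x n - y\<bar>) \<longlonglongrightarrow> 0"
    using tendsto_mult_right_zero[OF tendsto_rabs_zero[OF LIM_zero[OF lim]], of K] .
  then have "(\<lambda>n. c t w (x n) - c t w y) \<longlonglongrightarrow> 0"
    by (rule Lim_null_comparison[rotated]) (use le in auto)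
  then show "(c t w \<circ> x) \<longlonglongrightarrow> c t w y"
    by (simp add: LIM_zero_iff o_def)
qed

lemma set_integrable_field:
  assumes "continuous_on {0..} u" "continuous_on {0..} v"
  shows "set_integrable lborel {0..T} (\<lambda>t. c t (u t) (v t))"
proof (rule set_integrable_bound)
  show "set_integrable lborel {0..T} (\<lambda>_. B)"
    by (intro set_integrable_continuous_Icc continuous_intros)
  have [measurable]: "(\<lambda>t. indicator {0..T} t *\<^sub>R u t) \<in> borel_measurable borel"
    "(\<lambda>t. indicator {0..T} t *\<^sub>R v t) \<in> borel_measurable borel"
    using continuous_on_subset[OF assms(1), of "{0..T}"] continuous_on_subset[OF assms(2), of "{0..T}"]
    by (intro borel_measurable_continuous_on_indicator; simp)+
  \<comment> \<open>The functions u and v are arbitrary at negative times. Cutting them off inside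
    the field as well changes nothing on [0, T] and makes them Borel on the whole line.\<close>
  have "(\<lambda>t. indicator {0..T} t *\<^sub>R c t (u t) (v t)) = (\<lambda>t. indicator {0..T} t *\<^sub>R
      c t (indicator {0..T} t *\<^sub>R u t) (indicator {0..T} t *\<^sub>R v t))"
    by (auto simp: indicator_def)
  also have "\<dots> \<in> borel_measurable borel"
    by measurable
  finally show "set_borel_measurable lborel {0..T} (\<lambda>t. c t (u t) (v t))"
    by (simp add: set_borel_measurable_def)
  show "AE t in lborel. t \<in> {0..T} \<longrightarrow> norm (c t (u t) (v t)) \<le> norm B"
    using bound B_nonneg by auto
qed

lemma indefinite_integral_lipschitz:
  assumes f: "set_integrable lborel {0..T} f" and b: "\<And>t. t \<in> {0..T} \<Longrightarrow> \<bar>f t\<bar> \<le> B"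
    and "0 \<le> S" "S \<le> T"
  shows "\<bar>(LBINT t:{0..T}. f t) - (LBINT t:{0..S}. f t)\<bar> \<le> B * (T - S)"
proof -
  have split: "{0..T} = {0..S} \<union> {S<..T}" using assms by auto
  have int: "set_integrable lborel {0..S} f" "set_integrable lborel {S<..T} f"
    using assms by (auto intro: set_integrable_subset[OF f])
  have "(LBINT t:{0..T}. f t) = (LBINT t:{0..S}. f t) + (LBINT t:{S<..T}. f t)"
    unfolding split by (intro set_integral_Un int) auto
  moreover have "\<bar>LBINT t:{S<..T}. f t\<bar> \<le> (LBINT t:{S<..T}. \<bar>f t\<bar>)"
    unfolding set_lebesgue_integral_def
    by (rule order_trans[OF integral_abs_bound]) (simp add: abs_mult)
  moreover have "(LBINT t:{S<..T}. \<bar>f t\<bar>) \<le> (LBINT t:{S<..T}. B)"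
    using assms by (intro set_integral_mono set_integrable_abs int b)
      (auto simp: set_integrable_def)
  moreover have "(LBINT t:{S<..T}. B) = B * (T - S)"
    using assms by (simp add: set_integral_const measure_def)
  ultimately show ?thesis by simp
qed

lemma field_integral_lipschitz:
  assumes "continuous_on {0..} u" "continuous_on {0..} v" "0 \<le> S" "0 \<le> T"
  shows "\<bar>(LBINT t:{0..T}. c t (u t) (v t)) - (LBINT t:{0..S}. c t (u t) (v t))\<bar> \<le> B * \<bar>T - S\<bar>"
proof -
  have int: "set_integrable lborel {0..T} (\<lambda>t. c t (u t) (v t))" for T
    using assms by (intro set_integrable_field)
  show ?thesis
    using indefinite_integral_lipschitz[OF int, of T S] indefinite_integral_lipschitz[OF int, of S T]
      bound assms by (cases "S \<le> T") (auto simp: abs_minus_commute)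
qed

lemma lipschitz_imp_continuous:
  fixes F :: "real \<Rightarrow> real"
  assumes "\<And>S T. 0 \<le> S \<Longrightarrow> 0 \<le> T \<Longrightarrow> \<bar>F T - F S\<bar> \<le> B * \<bar>T - S\<bar>"
  shows "continuous_on {0..} F"
proof (rule lipschitz_on_continuous_on)
  show "B-lipschitz_on {0..} F"
    using B_nonneg assms by (intro lipschitz_onI) (auto simp: dist_real_def)
qed

text \<open>The Lipschitz bound is required only along the two given functions, so a constant for a
  box containing both can be inserted. The estimate serves the convergence of the iterates as well
  as uniqueness.\<close>

lemma set_integral_field_diff:
  assumes cont: "continuous_on {0..} \<omega>" "continuous_on {0..} g" "continuous_on {0..} h"
    and K: "\<And>t. t \<in> {0..T} \<Longrightarrow>
      \<bar>c t (\<omega> t) (g t + \<omega> t) - c t (\<omega> t) (h t + \<omega> t)\<bar> \<le> K * \<bar>g t - h t\<bar>"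
  shows "\<bar>(LBINT t:{0..T}. c t (\<omega> t) (g t + \<omega> t)) - (LBINT t:{0..T}. c t (\<omega> t) (h t + \<omega> t))\<bar>
    \<le> K * (LBINT t:{0..T}. \<bar>g t - h t\<bar>)"
proof -
  have cont': "continuous_on {0..T} \<omega>" "continuous_on {0..T} g" "continuous_on {0..T} h"
    by (auto intro: continuous_on_subset[OF cont(1)] continuous_on_subset[OF cont(2)]
        continuous_on_subset[OF cont(3)])
  have int: "set_integrable lborel {0..T} (\<lambda>t. c t (\<omega> t) (g t + \<omega> t))"
    "set_integrable lborel {0..T} (\<lambda>t. c t (\<omega> t) (h t + \<omega> t))"
    using cont by (intro set_integrable_field continuous_on_add; simp)+
  have "\<bar>(LBINT t:{0..T}. c t (\<omega> t) (g t + \<omega> t)) - (LBINT t:{0..T}. c t (\<omega> t) (h t + \<omega> t))\<bar>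
    = \<bar>LBINT t:{0..T}. c t (\<omega> t) (g t + \<omega> t) - c t (\<omega> t) (h t + \<omega> t)\<bar>"
    using int by simp
  also have "\<dots> \<le> (LBINT t:{0..T}. \<bar>c t (\<omega> t) (g t + \<omega> t) - c t (\<omega> t) (h t + \<omega> t)\<bar>)"
    unfolding set_lebesgue_integral_def
    by (rule order_trans[OF integral_abs_bound]) (simp add: abs_mult)
  also have "\<dots> \<le> (LBINT t:{0..T}. K * \<bar>g t - h t\<bar>)"
  proof (rule set_integral_mono)
    show "set_integrable lborel {0..T} (\<lambda>t. \<bar>c t (\<omega> t) (g t + \<omega> t) - c t (\<omega> t) (h t + \<omega> t)\<bar>)"
      by (rule set_integrable_abs[OF set_integral_diff(1)[OF int]])
    show "set_integrable lborel {0..T} (\<lambda>t. K * \<bar>g t - h t\<bar>)"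
      using cont' by (intro set_integrable_continuous_Icc continuous_intros)
  qed (rule K)
  finally show ?thesis by simp
qed

section \<open>Picard iterates, their limit, and uniqueness\<close>

primrec picard :: "(real \<Rightarrow> real) \<Rightarrow> nat \<Rightarrow> real \<Rightarrow> real" where
  "picard \<omega> 0 = (\<lambda>_. 0)"
| "picard \<omega> (Suc m) = (\<lambda>T. LBINT t:{0..T}. c t (\<omega> t) (picard \<omega> m t + \<omega> t))"

text \<open>The two claims go through the induction together: continuity of one iterate makes the
  next integrand integrable, and the bound on the field then returns the Lipschitz estimate. The
  constant B is the same for all m, so the limit inherits it.\<close>

lemma picard_lipschitz:
  assumes \<omega>: "continuous_on {0..} \<omega>"
  shows "continuous_on {0..} (picard \<omega> m) \<and>
    (\<forall>S T. 0 \<le> S \<longrightarrow> 0 \<le> T \<longrightarrow> \<bar>picard \<omega> m T - picard \<omega> m S\<bar> \<le> B * \<bar>T - S\<bar>)"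
proof (induction m)
  case 0
  then show ?case using B_nonneg by simp
next
  case (Suc m)
  have "\<bar>picard \<omega> (Suc m) T - picard \<omega> (Suc m) S\<bar> \<le> B * \<bar>T - S\<bar>" if "0 \<le> S" "0 \<le> T" for S T
    unfolding picard.simps
    using Suc \<omega> that by (intro field_integral_lipschitz continuous_on_add) auto
  then show ?case
    using lipschitz_imp_continuous[of "picard \<omega> (Suc m)"] by blast
qed

lemma set_integral_singleton_0 [simp]: "(LBINT t:{0::real}. f t) = (0::real)"
proof -
  have "(LBINT t:{0}. f t) = (LBINT t:{0::real}. f 0)"
    by (rule set_lebesgue_integral_cong) auto
  then show ?thesis by (simp add: set_integral_const)
qed

lemma picard_at_0: "picard \<omega> m 0 = 0"
  by (cases m) simp_all

lemma picard_bound: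
  assumes "continuous_on {0..} \<omega>" "0 \<le> t" "t \<le> T"
  shows "\<bar>picard \<omega> m t\<bar> \<le> B * T"
proof -
  have "\<bar>picard \<omega> m t - picard \<omega> m 0\<bar> \<le> B * \<bar>t - 0\<bar>"
    using picard_lipschitz[OF assms(1)] assms(2) by blast
  also have "\<dots> \<le> B * T"
    using assms B_nonneg by (auto intro!: mult_left_mono)
  finally show ?thesis by (simp add: picard_at_0)
qed

lemma locally_lipschitz_along_path:
  assumes \<omega>: "continuous_on {0..} \<omega>"
  obtains K where "0 < K" "\<And>t g h. t \<in> {0..T} \<Longrightarrow> \<bar>g\<bar> \<le> B * T \<Longrightarrow> \<bar>h\<bar> \<le> B * T \<Longrightarrow>
    \<bar>c t (\<omega> t) (g + \<omega> t) - c t (\<omega> t) (h + \<omega> t)\<bar> \<le> K * \<bar>g - h\<bar>"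
proof -
  obtain M where M: "0 \<le> M" "\<And>t. t \<in> {0..T} \<Longrightarrow> \<bar>\<omega> t\<bar> \<le> M"
    using continuous_on_bounded_abs[OF \<omega>] by blast
  \<comment> \<open>The radius adds the bound on g and h to the bound on the path;
    \<open>\<bar>T\<bar>\<close> keeps it nonnegative when T has no sign.\<close>
  obtain K where K: "0 < K" "\<And>t w y1 y2. t \<in> {0..T} \<Longrightarrow> \<bar>w\<bar> \<le> B * \<bar>T\<bar> + M \<Longrightarrow>
    \<bar>y1\<bar> \<le> B * \<bar>T\<bar> + M \<Longrightarrow> \<bar>y2\<bar> \<le> B * \<bar>T\<bar> + M \<Longrightarrow> \<bar>c t w y1 - c t w y2\<bar> \<le> K * \<bar>y1 - y2\<bar>"
    using locally_lipschitz by blast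
  have BT: "0 \<le> B * \<bar>T\<bar>" "B * T \<le> B * \<bar>T\<bar>"
    using B_nonneg by (auto intro!: mult_left_mono)
  show thesis
  proof
    fix t g h assume "t \<in> {0..T}" "\<bar>g\<bar> \<le> B * T" "\<bar>h\<bar> \<le> B * T"
    then have "\<bar>c t (\<omega> t) (g + \<omega> t) - c t (\<omega> t) (h + \<omega> t)\<bar> \<le> K * \<bar>(g + \<omega> t) - (h + \<omega> t)\<bar>"
      using M(2)[of t] BT by (intro K(2)) linarith+
    then show "\<bar>c t (\<omega> t) (g + \<omega> t) - c t (\<omega> t) (h + \<omega> t)\<bar> \<le> K * \<bar>g - h\<bar>"
      by simp
  qed fact
qed

lemma convergent_picard:
  assumes \<omega>: "continuous_on {0..} \<omega>" and T: "0 \<le> T"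
  shows "convergent (\<lambda>m. picard \<omega> m T)"
proof -
  obtain K where K: "0 < K" "\<And>t g h. t \<in> {0..T} \<Longrightarrow> \<bar>g\<bar> \<le> B * T \<Longrightarrow> \<bar>h\<bar> \<le> B * T \<Longrightarrow>
    \<bar>c t (\<omega> t) (g + \<omega> t) - c t (\<omega> t) (h + \<omega> t)\<bar> \<le> K * \<bar>g - h\<bar>"
    using locally_lipschitz_along_path[OF \<omega>] by blast
  note cont_p = conjunct1[OF picard_lipschitz[OF \<omega>]]
  have step: "\<bar>picard \<omega> (Suc m) t - picard \<omega> m t\<bar> \<le> B * T * (1/2)^m * exp (2 * K * t)"
    if "t \<in> {0..T}" for m t
    using that
  proof (induction m arbitrary: t)
    case 0
    have "\<bar>picard \<omega> (Suc 0) t\<bar> \<le> B * T"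
      using \<omega> 0 by (intro picard_bound) auto
    also have "B * T * 1 \<le> B * T * exp (2 * K * t)"
      using 0 T B_nonneg K(1) by (intro mult_left_mono) auto
    finally show ?case by simp
  next
    case (Suc m)
    have bd: "\<bar>picard \<omega> m' s\<bar> \<le> B * T" if "s \<in> {0..t}" for m' s
      using that Suc.prems by (intro picard_bound \<omega>) auto
    have "\<bar>picard \<omega> (Suc (Suc m)) t - picard \<omega> (Suc m) t\<bar>
      \<le> K * (LBINT s:{0..t}. \<bar>picard \<omega> (Suc m) s - picard \<omega> m s\<bar>)"
      unfolding picard.simps(2)[of \<omega> "Suc m"] picard.simps(2)[of \<omega> m, THEN fun_cong, of t]
      using Suc.prems by (intro set_integral_field_diff \<omega> cont_p K(2) bd) auto
    also have "\<dots> \<le> K * (LBINT s:{0..t}. B * T * (1/2)^m * exp (2 * K * s))"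
      using K(1) Suc.prems
      by (intro mult_left_mono set_integral_mono Suc.IH set_integrable_continuous_Icc
          continuous_intros continuous_on_subset[OF cont_p]) auto
    \<comment> \<open>K times the integral of \<open>exp (2 * K * s)\<close> over [0, t] is half of
      \<open>exp (2 * K * t) - 1\<close>; this is the factor gained at each step.\<close>
    also have "\<dots> = B * T * (1/2)^Suc m * (exp (2 * K * t) - 1)"
      using K(1) Suc.prems by (simp add: set_integral_exp)
    also have "\<dots> \<le> B * T * (1/2)^Suc m * exp (2 * K * t)"
      using T B_nonneg by (intro mult_left_mono) auto
    finally show ?case .
  qed
  have "summable (\<lambda>m. picard \<omega> (Suc m) T - picard \<omega> m T)"
  proof (rule summable_comparison_test')
    show "summable (\<lambda>m. B * T * (1/2)^m * exp (2 * K * T))"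
      by (intro summable_mult summable_mult2 summable_geometric) auto
    show "norm (picard \<omega> (Suc m) T - picard \<omega> m T) \<le> B * T * (1/2)^m * exp (2 * K * T)" for m
      using step[of T m] T by simp
  qed
  \<comment> \<open>The partial sums telescope to the iterates themselves because the zeroth iterate
    vanishes.\<close>
  from summable_LIMSEQ[OF this] show ?thesis
    unfolding sum_lessThan_telescope[of "\<lambda>i. picard \<omega> i T"] convergent_def
    by (auto simp only: picard.simps(1) diff_zero)
qed

text \<open>A limit for each pair of time and path, rather than a description by the equation, so
  that joint measurability of the iterates carries over. Only continuous paths and nonnegative times
  matter.\<close>

definition solution :: "(real \<Rightarrow> real) \<Rightarrow> real \<Rightarrow> real" where
  "solution \<omega> T = lim (\<lambda>m. picard \<omega> m T)"

lemma picard_tendsto_solution: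
  "continuous_on {0..} \<omega> \<Longrightarrow> 0 \<le> T \<Longrightarrow> (\<lambda>m. picard \<omega> m T) \<longlonglongrightarrow> solution \<omega> T"
  unfolding solution_def using convergent_picard convergent_LIMSEQ_iff by blast

text \<open>The Lipschitz constant is common to all iterates, so pointwise convergence is
  enough.\<close>

lemma continuous_on_solution:
  assumes \<omega>: "continuous_on {0..} \<omega>"
  shows "continuous_on {0..} (solution \<omega>)"
proof (rule lipschitz_imp_continuous)
  fix S T :: real assume ST: "0 \<le> S" "0 \<le> T"
  then have "(\<lambda>m. \<bar>picard \<omega> m T - picard \<omega> m S\<bar>) \<longlonglongrightarrow> \<bar>solution \<omega> T - solution \<omega> S\<bar>"
    by (intro tendsto_intros picard_tendsto_solution \<omega>)
  then show "\<bar>solution \<omega> T - solution \<omega> S\<bar> \<le> B * \<bar>T - S\<bar>"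
    using picard_lipschitz[OF \<omega>] ST by (intro LIMSEQ_le_const2) auto
qed

text \<open>Both sides of the recursion pass to the limit: on [0, T] the integrands are dominated by
  B, so uniform convergence of the iterates is not called for.\<close>

lemma solution_eq:
  assumes \<omega>: "continuous_on {0..} \<omega>" and T: "0 \<le> T"
  shows "solution \<omega> T = (LBINT t:{0..T}. c t (\<omega> t) (solution \<omega> t + \<omega> t))"
proof -
  note cont_p = conjunct1[OF picard_lipschitz[OF \<omega>]]
  have int: "set_integrable lborel {0..T} (\<lambda>t. c t (\<omega> t) (g t + \<omega> t))"
    if "continuous_on {0..} g" for g
    using that \<omega> by (intro set_integrable_field continuous_on_add)
  have "(\<lambda>m. picard \<omega> (Suc m) T) \<longlonglongrightarrow> (LBINT t:{0..T}. c t (\<omega> t) (solution \<omega> t + \<omega> t))"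
    unfolding picard.simps set_lebesgue_integral_def
  proof (rule integral_dominated_convergence)
    show "integrable lborel (\<lambda>t. indicator {0..T} t *\<^sub>R B)"
      using set_integrable_continuous_Icc[of T "\<lambda>_. B"] by (simp add: set_integrable_def)
    show "(\<lambda>t. indicat_real {0..T} t *\<^sub>R c t (\<omega> t) (solution \<omega> t + \<omega> t)) \<in> borel_measurable lborel"
      using int[OF continuous_on_solution[OF \<omega>]] unfolding set_integrable_def
      by (rule borel_measurable_integrable)
    show "(\<lambda>t. indicat_real {0..T} t *\<^sub>R c t (\<omega> t) (picard \<omega> m t + \<omega> t)) \<in> borel_measurable lborel" for m
      using int[OF cont_p] unfolding set_integrable_def
      by (rule borel_measurable_integrable)
    have "(\<lambda>m. c t (\<omega> t) (picard \<omega> m t + \<omega> t)) \<longlonglongrightarrow> c t (\<omega> t) (solution \<omega> t + \<omega> t)" if "0 \<le> t" for t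
      using that by (intro continuous_on_tendsto_compose[OF field_continuous_state]
          tendsto_intros picard_tendsto_solution \<omega>) auto
    then show "AE t in lborel. (\<lambda>m. indicat_real {0..T} t *\<^sub>R c t (\<omega> t) (picard \<omega> m t + \<omega> t))
      \<longlonglongrightarrow> indicat_real {0..T} t *\<^sub>R c t (\<omega> t) (solution \<omega> t + \<omega> t)"
      by (auto simp: indicator_def)
    show "AE t in lborel. norm (indicat_real {0..T} t *\<^sub>R c t (\<omega> t) (picard \<omega> m t + \<omega> t))
      \<le> indicator {0..T} t *\<^sub>R B" for m
      using bound by (auto simp: indicator_def)
  qed
  with LIMSEQ_Suc[OF picard_tendsto_solution[OF \<omega> T]] show ?thesis
    using LIMSEQ_unique by blast
qed

lemma solution_bound:
  assumes "continuous_on {0..} \<omega>" "0 \<le> t" "t \<le> T"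
  shows "\<bar>solution \<omega> t\<bar> \<le> B * T"
  using picard_tendsto_solution[OF assms(1,2)] picard_bound[OF assms]
  by (intro LIMSEQ_le_const2[OF tendsto_rabs]) auto

text \<open>The competitor is not assumed continuous. The equation itself makes it B-Lipschitz,
  hence confined to the same box as the constructed solution, and Gronwall with zero error
  applies.\<close>

lemma solution_unique:
  assumes \<omega>: "continuous_on {0..} \<omega>"
    and int: "\<And>T. 0 \<le> T \<Longrightarrow> set_integrable lborel {0..T} (\<lambda>t. c t (\<omega> t) (\<Gamma> t + \<omega> t))"
    and eq: "\<And>T. 0 \<le> T \<Longrightarrow> \<Gamma> T = (LBINT t:{0..T}. c t (\<omega> t) (\<Gamma> t + \<omega> t))"
    and T: "0 \<le> T"
  shows "\<Gamma> T = solution \<omega> T"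
proof -
  have lip: "\<bar>\<Gamma> T - \<Gamma> S\<bar> \<le> B * \<bar>T - S\<bar>" if "0 \<le> S" "0 \<le> T" for S T
    unfolding eq[OF that(1)] eq[OF that(2)]
    using that indefinite_integral_lipschitz[OF int, of T S]
      indefinite_integral_lipschitz[OF int, of S T] bound
    by (cases "S \<le> T") (auto simp: abs_minus_commute)
  note cont_\<Gamma> = lipschitz_imp_continuous[of \<Gamma>, OF lip] and cont_s = continuous_on_solution[OF \<omega>]
  have bd: "\<bar>\<Gamma> t\<bar> \<le> B * T" if "t \<in> {0..T}" for t
  proof -
    have "\<bar>\<Gamma> t\<bar> \<le> B * t"
      using lip[of 0 t] eq[of 0] that by simp
    also have "\<dots> \<le> B * T"
      using that B_nonneg by (auto intro!: mult_left_mono)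
    finally show ?thesis .
  qed
  obtain K where K: "0 < K" "\<And>t g h. t \<in> {0..T} \<Longrightarrow> \<bar>g\<bar> \<le> B * T \<Longrightarrow> \<bar>h\<bar> \<le> B * T \<Longrightarrow>
    \<bar>c t (\<omega> t) (g + \<omega> t) - c t (\<omega> t) (h + \<omega> t)\<bar> \<le> K * \<bar>g - h\<bar>"
    using locally_lipschitz_along_path[OF \<omega>] by blast
  have "\<bar>\<Gamma> T - solution \<omega> T\<bar> \<le> 2 * 0 * exp (2 * K * T)"
  proof (rule gronwall[where T = T and D = "\<lambda>t. \<bar>\<Gamma> t - solution \<omega> t\<bar>"])
    show "continuous_on {0..T} (\<lambda>t. \<bar>\<Gamma> t - solution \<omega> t\<bar>)"
      by (intro continuous_intros continuous_on_subset[OF cont_\<Gamma>] continuous_on_subset[OF cont_s]) auto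
    fix t assume t: "t \<in> {0..T}"
    have "\<bar>\<Gamma> t - solution \<omega> t\<bar> \<le> K * (LBINT s:{0..t}. \<bar>\<Gamma> s - solution \<omega> s\<bar>)"
    proof -
      have "\<Gamma> t - solution \<omega> t = (LBINT s:{0..t}. c s (\<omega> s) (\<Gamma> s + \<omega> s)) -
          (LBINT s:{0..t}. c s (\<omega> s) (solution \<omega> s + \<omega> s))"
        using eq[of t] solution_eq[OF \<omega>, of t] t by simp
      then show ?thesis
        using t by (auto intro!: set_integral_field_diff \<omega> cont_\<Gamma> cont_s K(2) bd solution_bound)
    qed
    then show "\<bar>\<Gamma> t - solution \<omega> t\<bar> \<le> 0 + K * (LBINT s:{0..t}. \<bar>\<Gamma> s - solution \<omega> s\<bar>)"
      by simp
  qed (use K T in auto)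
  then show ?thesis by simp
qed

text \<open>The difference of the two fields splits into a change of w at the fixed limiting state,
  which tends to zero in the integral, and a change of the state, which the Lipschitz bound turns
  into a Gronwall term.\<close>

lemma solution_stable:
  assumes \<omega>: "continuous_on {0..} \<omega>" and \<omega>k: "\<And>k. continuous_on {0..} (\<omega>k k)"
    and lim: "uniform_limit {0..T} \<omega>k \<omega> sequentially" and T: "0 \<le> T"
  shows "uniform_limit {0..T} (\<lambda>k. solution (\<omega>k k)) (solution \<omega>) sequentially"
proof -
  note cont_s = continuous_on_solution[OF \<omega>] continuous_on_solution[OF \<omega>k]
  obtain M where M: "0 \<le> M" "\<And>t. t \<in> {0..T} \<Longrightarrow> \<bar>\<omega> t\<bar> \<le> M"
    using continuous_on_bounded_abs[OF \<omega>] by blast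
  \<comment> \<open>The extra 1 leaves room for the perturbed paths, which eventually stay within
    distance 1 of the limit path on [0, T]. One K thus serves almost all k.\<close>
  obtain K where K: "0 < K" "\<And>t w y1 y2. t \<in> {0..T} \<Longrightarrow> \<bar>w\<bar> \<le> B * T + M + 1 \<Longrightarrow>
    \<bar>y1\<bar> \<le> B * T + M + 1 \<Longrightarrow> \<bar>y2\<bar> \<le> B * T + M + 1 \<Longrightarrow> \<bar>c t w y1 - c t w y2\<bar> \<le> K * \<bar>y1 - y2\<bar>"
    using locally_lipschitz by blast
  define y where "y t = solution \<omega> t + \<omega> t" for t
  define a where "a k t = \<bar>c t (\<omega>k k t) (y t) - c t (\<omega> t) (y t)\<bar>" for k t
  have cont_y: "continuous_on {0..} y"
    unfolding y_def by (intro continuous_on_add cont_s \<omega>)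
  have int_c: "set_integrable lborel {0..t} (\<lambda>t. c t (\<omega>k k t) (y t))"
    "set_integrable lborel {0..t} (\<lambda>t. c t (\<omega> t) (y t))"
    "set_integrable lborel {0..t} (\<lambda>t. c t (\<omega>k k t) (solution (\<omega>k k) t + \<omega>k k t))" for k t
    by (intro set_integrable_field continuous_on_add cont_s \<omega> \<omega>k cont_y)+
  have int_a: "set_integrable lborel {0..t} (a k)" for k t
    unfolding a_def by (rule set_integrable_abs[OF set_integral_diff(1)[OF int_c(1,2)]])
  have "(\<lambda>k. LBINT t:{0..T}. a k t) \<longlonglongrightarrow> (LBINT t:{0..T}. 0)"
    unfolding set_lebesgue_integral_def
  proof (rule integral_dominated_convergence)
    show "integrable lborel (\<lambda>t. indicator {0..T} t *\<^sub>R (2 * B))"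
      using set_integrable_continuous_Icc[of T "\<lambda>_. 2 * B"] by (simp add: set_integrable_def)
    show "(\<lambda>t. indicat_real {0..T} t *\<^sub>R a k t) \<in> borel_measurable lborel" for k
      using int_a unfolding set_integrable_def by (rule borel_measurable_integrable)
    have "(\<lambda>k. a k t) \<longlonglongrightarrow> 0" if t: "t \<in> {0..T}" for t
    proof -
      have "(\<lambda>k. c t (\<omega>k k t) (y t)) \<longlonglongrightarrow> c t (\<omega> t) (y t)"
        using tendsto_uniform_limitI[OF lim t] cont
        by (intro continuous_on_tendsto_compose[OF cont, of _ "\<omega> t"]) auto
      then show ?thesis
        unfolding a_def by (intro tendsto_rabs_zero LIM_zero)
    qed
    then show "AE t in lborel. (\<lambda>k. indicat_real {0..T} t *\<^sub>R a k t) \<longlonglongrightarrow> indicat_real {0..T} t *\<^sub>R 0"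
      by (auto simp: indicator_def)
    have "a k t \<le> 2 * B" for k t
      unfolding a_def using bound[of t "\<omega>k k t" "y t"] bound[of t "\<omega> t" "y t"] by linarith
    then show "AE t in lborel. norm (indicat_real {0..T} t *\<^sub>R a k t) \<le> indicator {0..T} t *\<^sub>R (2 * B)" for k
      by (auto simp: indicator_def a_def)
  qed simp
  then have lim_a: "(\<lambda>k. LBINT t:{0..T}. a k t) \<longlonglongrightarrow> 0"
    by simp
  show ?thesis
  proof (rule uniform_limitI)
    fix e :: real assume e: "0 < e"
    \<comment> \<open>Gronwall is applied with error \<open>d + K * T * d\<close>, where the first d
      bounds the integral of \<open>a k\<close> and the second comes from the distance of the paths;
      C collects the resulting factor of d.\<close>
    define C where "C = 2 * (1 + K * T) * exp (2 * K * T)"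
    have C: "0 < C"
      using K(1) T unfolding C_def by (intro mult_pos_pos) (auto intro: add_pos_nonneg)
    define d where "d = min 1 (e / (2 * C))"
    have d: "0 < d" "d \<le> 1" "C * d < e"
      using C e by (auto simp: d_def min_def field_simps)
    have "\<forall>\<^sub>F k in sequentially. \<forall>t\<in>{0..T}. dist (\<omega>k k t) (\<omega> t) < d"
      using lim d(1) by (rule uniform_limitD)
    moreover have "\<forall>\<^sub>F k in sequentially. (LBINT t:{0..T}. a k t) < d"
      using lim_a d(1) by (rule order_tendstoD)
    ultimately show "\<forall>\<^sub>F k in sequentially. \<forall>t\<in>{0..T}. dist (solution (\<omega>k k) t) (solution \<omega> t) < e"
    proof eventually_elim
      case (elim k)
      have close: "\<bar>\<omega>k k t - \<omega> t\<bar> \<le> d" if "t \<in> {0..T}" for t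
        using elim(1) that by (auto simp: dist_real_def intro: less_imp_le)
      define D where "D t = \<bar>solution (\<omega>k k) t - solution \<omega> t\<bar>" for t
      have cont_D: "continuous_on {0..t} D" for t
        unfolding D_def by (intro continuous_intros continuous_on_subset[OF cont_s(1)]
            continuous_on_subset[OF cont_s(2)]) auto
      have pointwise: "\<bar>c s (\<omega>k k s) (solution (\<omega>k k) s + \<omega>k k s) - c s (\<omega> s) (y s)\<bar>
          \<le> a k s + (K * d + K * D s)" if s: "s \<in> {0..T}" for s
      proof -
        have b: "\<bar>solution \<omega> s\<bar> \<le> B * T" "\<bar>solution (\<omega>k k) s\<bar> \<le> B * T"
          using s by (auto intro!: solution_bound \<omega> \<omega>k)
        have BT: "0 \<le> B * T"
          using B_nonneg T by simp
        have "\<bar>c s (\<omega>k k s) (solution (\<omega>k k) s + \<omega>k k s) - c s (\<omega>k k s) (y s)\<bar>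
          \<le> K * \<bar>(solution (\<omega>k k) s + \<omega>k k s) - y s\<bar>"
          unfolding y_def using b BT M(2)[OF s] close[OF s] d(2) s by (intro K(2)) linarith+
        also have "\<dots> \<le> K * (d + D s)"
          using K(1) close[OF s] unfolding y_def D_def by (intro mult_left_mono) linarith+
        finally show ?thesis
          unfolding a_def by (simp add: distrib_left)
      qed
      have "D t < e" if t: "t \<in> {0..T}" for t
      proof -
        have "D t \<le> 2 * (d + K * T * d) * exp (2 * K * t)"
        proof (rule gronwall[OF cont_D K(1) _ _ t])
          show "0 \<le> d + K * T * d"
            using d K T by simp
          fix t assume t: "t \<in> {0..T}"
          have int_D: "set_integrable lborel {0..t} D"
            by (intro set_integrable_continuous_Icc cont_D)
          have int_K: "set_integrable lborel {0..t} (\<lambda>s. K * d)"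
            "set_integrable lborel {0..t} (\<lambda>s. K * D s)"
            using int_D by (auto intro: set_integrable_continuous_Icc)
          have int_KD: "set_integrable lborel {0..t} (\<lambda>s. K * d + K * D s)"
            by (rule set_integral_add(1)[OF int_K])
          have "D t = \<bar>(LBINT s:{0..t}. c s (\<omega>k k s) (solution (\<omega>k k) s + \<omega>k k s)) -
              (LBINT s:{0..t}. c s (\<omega> s) (y s))\<bar>"
            using t solution_eq[OF \<omega>, of t] solution_eq[OF \<omega>k, of t k] by (simp add: D_def y_def)
          also have "\<dots> = \<bar>LBINT s:{0..t}. c s (\<omega>k k s) (solution (\<omega>k k) s + \<omega>k k s) - c s (\<omega> s) (y s)\<bar>"
            by (subst set_integral_diff(2)[OF int_c(3,2)]) (rule refl)
          also have "\<dots> \<le> (LBINT s:{0..t}. \<bar>c s (\<omega>k k s) (solution (\<omega>k k) s + \<omega>k k s) - c s (\<omega> s) (y s)\<bar>)"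
            unfolding set_lebesgue_integral_def
            by (rule order_trans[OF integral_abs_bound]) (simp add: abs_mult)
          also have "\<dots> \<le> (LBINT s:{0..t}. a k s + (K * d + K * D s))"
            using t pointwise
            by (intro set_integral_mono set_integrable_abs[OF set_integral_diff(1)[OF int_c(3,2)]]
                set_integral_add(1)[OF int_a int_KD]) auto
          also have "\<dots> = (LBINT s:{0..t}. a k s) + (t * (K * d) + K * (LBINT s:{0..t}. D s))"
            using t by (simp add: set_integral_add(2)[OF int_a int_KD] set_integral_add(2)[OF int_K]
                set_integral_const measure_def)
          \<comment> \<open>Extending the integral of the nonnegative \<open>a k\<close> to T makes
            the error independent of t, as \<open>gronwall\<close> demands.\<close>
          also have "(LBINT s:{0..t}. a k s) \<le> (LBINT s:{0..T}. a k s)"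
            unfolding set_lebesgue_integral_def using t int_a
            by (intro integral_mono) (auto simp: set_integrable_def indicator_def a_def)
          also have "t * (K * d) \<le> T * (K * d)"
            using t K d by (intro mult_right_mono) auto
          finally show "D t \<le> d + K * T * d + K * (LBINT s:{0..t}. D s)"
            using elim(2) by (simp add: mult_ac)
        qed
        also have "\<dots> \<le> 2 * (d + K * T * d) * exp (2 * K * T)"
          using t d K T by (intro mult_left_mono) auto
        also have "\<dots> = C * d"
          by (simp add: C_def algebra_simps)
        finally show ?thesis using d by simp
      qed
      then show ?case by (simp add: D_def dist_real_def)
    qed
  qed
qed

end

section \<open>Joint measurability in time and path\<close>

lemma space_coord_filtration: "space (coord_filtration t) = cpaths UNIV"
  unfolding coord_filtration_def by (rule space_measure_of) auto

lemma coordinate_measurable: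
  assumes "s \<in> {0..t}"
  shows "(\<lambda>\<omega>. \<omega> s) \<in> borel_measurable (coord_filtration t)"
proof (rule measurableI)
  fix A :: "real set" assume "A \<in> sets borel"
  then have "(\<lambda>\<omega>. \<omega> s) -` A \<inter> cpaths UNIV \<in>
      {(\<lambda>\<omega>. \<omega> s) -` A \<inter> cpaths UNIV | s A. s \<in> {0..t} \<and> A \<in> sets borel}"
    using assms by blast
  then show "(\<lambda>\<omega>. \<omega> s) -` A \<inter> space (coord_filtration t) \<in> sets (coord_filtration t)"
    unfolding space_coord_filtration
    unfolding coord_filtration_def by (subst sets_measure_of) auto
qed simp

text \<open>Continuous paths are limits of the step paths obtained by rounding time down to
  multiples of \<open>1 / (n + 1)\<close>.\<close>

lemma evaluation_measurable:
  assumes "0 \<le> t"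
  shows "(\<lambda>(s, \<omega>). \<omega> s) \<in> borel_measurable (restrict_space borel {0..t} \<Otimes>\<^sub>M coord_filtration t)"
    (is "_ \<in> borel_measurable ?M")
proof (rule borel_measurable_LIMSEQ_real)
  \<comment> \<open>The cap at t keeps each sampled coordinate measurable for
    \<open>coord_filtration t\<close>, and the floor at 0 covers negative integers i. For s in
    [0, t] neither bound changes the rounded time.\<close>
  let ?r = "\<lambda>n i. min t (max 0 (real_of_int i / real (Suc n)))"
  let ?u = "\<lambda>n s. ?r n \<lfloor>real (Suc n) * s\<rfloor>"
  show "(\<lambda>(s, \<omega>). \<omega> (?u n s)) \<in> borel_measurable ?M" for n
  proof -
    have [measurable]: "(\<lambda>x. fst x) \<in> borel_measurable ?M"
      by (rule measurable_compose[OF measurable_fst]) (rule measurable_restrict_space1, simp)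
    have coord: "(\<lambda>x. snd x (?r n i)) \<in> borel_measurable ?M" for i
      using assms by (intro measurable_compose[OF measurable_snd] coordinate_measurable) auto
    \<comment> \<open>For each fixed integer i the map is a single coordinate; the rounded time
      selects among countably many of them measurably.\<close>
    have "(\<lambda>x. snd x (?r n \<lfloor>real (Suc n) * fst x\<rfloor>)) \<in> borel_measurable ?M"
      by (rule measurable_compose_countable[where f = "\<lambda>i x. snd x (?r n i)", OF coord]) measurable
    then show ?thesis by (simp add: split_beta)
  qed
  fix x assume "x \<in> space ?M"
  then obtain s \<omega> where x: "x = (s, \<omega>)" and s: "s \<in> {0..t}" and \<omega>: "\<omega> \<in> cpaths UNIV"
    by (auto simp: space_pair_measure space_restrict_space space_coord_filtration)
  have u: "\<bar>?u n s - s\<bar> \<le> 1 / real (Suc n) \<and> 0 \<le> ?u n s" for n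
  proof -
    have "real_of_int \<lfloor>real (Suc n) * s\<rfloor> / real (Suc n) \<le> s"
      by (simp add: divide_le_eq mult.commute)
    moreover have "s \<le> (real_of_int \<lfloor>real (Suc n) * s\<rfloor> + 1) / real (Suc n)"
      unfolding pos_le_divide_eq[of "real (Suc n)", simplified]
      using floor_correct[of "real (Suc n) * s"] by (simp add: field_simps)
    moreover have "0 \<le> real_of_int \<lfloor>real (Suc n) * s\<rfloor> / real (Suc n)"
      using s by simp
    ultimately show ?thesis
      using s by (auto simp: add_divide_distrib)
  qed
  have "(\<lambda>n. ?u n s - s) \<longlonglongrightarrow> 0"
    by (rule Lim_null_comparison[OF _ LIMSEQ_inverse_real_of_nat])
       (use u in \<open>auto simp: inverse_eq_divide\<close>)
  then have "(\<lambda>n. ?u n s) \<longlonglongrightarrow> s"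
    by (rule LIM_zero_cancel)
  then have "(\<lambda>n. \<omega> (?u n s)) \<longlonglongrightarrow> \<omega> s"
    using \<omega> s u by (intro continuous_on_tendsto_compose[of "{0..}" \<omega>]) (auto simp: cpaths_def)
  then show "(\<lambda>n. case x of (s, \<omega>) \<Rightarrow> \<omega> (?u n s)) \<longlonglongrightarrow> (case x of (s, \<omega>) \<Rightarrow> \<omega> s)"
    by (simp add: x)
qed

context integral_equation
begin

text \<open>Each iterate is an integral with parameter (T, \<omega>), and integrals of jointly
  measurable functions are measurable in the parameter. The path is consulted only up to time t,
  which is why \<open>coord_filtration t\<close> suffices.\<close>

lemma picard_measurable:
  assumes "0 \<le> t"
  shows "(\<lambda>(T, \<omega>). picard \<omega> m T) \<in> borel_measurable (restrict_space borel {0..t} \<Otimes>\<^sub>M coord_filtration t)"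
    (is "_ \<in> borel_measurable ?M")
proof (induction m)
  case 0
  then show ?case by simp
next
  case (Suc m)
  let ?I = "restrict_space lborel {0..t}"
  have sets_I: "sets ?I = sets (restrict_space borel {0..t})"
    by (rule sets_restrict_space_cong) simp
  interpret I: finite_measure ?I
    using assms by (intro finite_measureI) (simp add: emeasure_restrict_space space_restrict_space)
  have fst_borel: "fst \<in> borel_measurable (restrict_space borel {0..t} \<Otimes>\<^sub>M N)" for N :: "'z measure"
    by (rule measurable_compose[OF measurable_fst]) (rule measurable_restrict_space1, simp)
  have [measurable]: "(\<lambda>p. fst (fst p)) \<in> borel_measurable (?M \<Otimes>\<^sub>M ?I)"
    by (rule measurable_compose[OF measurable_fst fst_borel])
  have [measurable]: "snd \<in> borel_measurable (?M \<Otimes>\<^sub>M ?I)"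
    by (rule measurable_compose[OF measurable_snd]) (rule measurable_restrict_space1, simp)
  \<comment> \<open>Replacing the outer time T by the integration time s lets the induction
    hypothesis and \<open>evaluation_measurable\<close> be used under the integral.\<close>
  have swap: "(\<lambda>p. (snd p, snd (fst p))) \<in> ?M \<Otimes>\<^sub>M ?I \<rightarrow>\<^sub>M ?M"
    by (intro measurable_Pair measurable_compose[OF measurable_fst measurable_snd])
       (simp add: measurable_cong_sets[OF refl sets_I[symmetric]])
  have [measurable]: "(\<lambda>p. snd (fst p) (snd p)) \<in> borel_measurable (?M \<Otimes>\<^sub>M ?I)"
    using measurable_compose[OF swap evaluation_measurable[OF assms]] by simp
  have [measurable]: "(\<lambda>p. picard (snd (fst p)) m (snd p)) \<in> borel_measurable (?M \<Otimes>\<^sub>M ?I)"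
    using measurable_compose[OF swap Suc] by simp
  \<comment> \<open>The variable upper limit moves into the integrand, so that the measure
    \<open>?I\<close> does not depend on the parameter.\<close>
  have "(\<lambda>x. \<integral>s. (if 0 \<le> s \<and> s \<le> fst x then c s (snd x s) (picard (snd x) m s + snd x s) else 0) \<partial>?I)
      \<in> borel_measurable ?M"
    by (rule I.borel_measurable_lebesgue_integral) (simp add: split_beta)
  also have "?this \<longleftrightarrow> ?case"
  proof (rule measurable_cong)
    fix x assume "x \<in> space ?M"
    then have "{0..t} \<inter> {0..fst x} = {0..fst x}"
      by (auto simp: space_pair_measure space_restrict_space)
    then show "(\<integral>s. (if 0 \<le> s \<and> s \<le> fst x then c s (snd x s) (picard (snd x) m s + snd x s) else 0) \<partial>?I)
      = (case x of (T, \<omega>) \<Rightarrow> picard \<omega> (Suc m) T)"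
      unfolding split_beta picard.simps set_lebesgue_integral_def
      by (subst integral_restrict_space)
        (auto intro!: Bochner_Integration.integral_cong simp: indicator_def set_eq_iff)
  qed
  finally show ?case .
qed

lemma solution_measurable:
  assumes "0 \<le> t"
  shows "(\<lambda>(s, \<omega>). solution \<omega> s) \<in> borel_measurable (restrict_space borel {0..t} \<Otimes>\<^sub>M coord_filtration t)"
proof (rule borel_measurable_LIMSEQ_real[OF _ picard_measurable[OF assms]])
  fix x assume "x \<in> space (restrict_space borel {0..t} \<Otimes>\<^sub>M coord_filtration t)"
  then show "(\<lambda>m. case x of (T, \<omega>) \<Rightarrow> picard \<omega> m T) \<longlonglongrightarrow> (case x of (s, \<omega>) \<Rightarrow> solution \<omega> s)"
    by (auto simp: space_pair_measure space_restrict_space space_coord_filtration cpaths_def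
        intro!: picard_tendsto_solution)
qed

end

section \<open>The function \<open>H\<close> and its inverse\<close>

lemma Icc_subset_einterval:
  assumes "a \<in> einterval l r" "b \<in> einterval l r"
  shows "{a..b} \<subseteq> einterval l r"
proof
  fix x assume "x \<in> {a..b}"
  then have "ereal a \<le> ereal x" "ereal x \<le> ereal b" by auto
  with assms show "x \<in> einterval l r"
    unfolding einterval_iff by (meson le_less_trans less_le_trans)
qed

text \<open>The limits are taken over extended reals, so finite and infinite endpoints are treated
  alike.\<close>

locale barrow_osgood =
  fixes l r :: ereal and x0 :: real and s :: "real \<Rightarrow> real"
  assumes x0: "x0 \<in> einterval l r"
    and s_pos: "\<And>x. x \<in> einterval l r \<Longrightarrow> 0 < s x"
    and s_meas: "s \<in> borel_measurable (restrict_space borel (einterval l r))"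
    and s_var: "\<And>K. compact K \<Longrightarrow> K \<subseteq> einterval l r \<Longrightarrow> finite_variation_on K (\<lambda>z. ln (s z))"
    and H_left: "filterlim (H_fun s x0 \<circ> real_of_ereal) at_bot (at_right l)"
    and H_right: "filterlim (H_fun s x0 \<circ> real_of_ereal) at_top (at_left r)"
begin

abbreviation "\<I> \<equiv> einterval l r"
abbreviation "H \<equiv> H_fun s x0"
abbreviation "\<Theta> \<equiv> Theta l r s x0"

text \<open>The variation over the two-point partition from a to x already bounds
  \<open>\<bar>ln (s x) - ln (s a)\<bar>\<close>, uniformly in x; exponentiating gives both
  bounds.\<close>

lemma s_bounds:
  assumes "a \<in> \<I>" "b \<in> \<I>"
  obtains m M where "0 < m" "0 < M" "\<And>x. x \<in> {a..b} \<Longrightarrow> m \<le> s x \<and> s x \<le> M"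
proof -
  note sub = Icc_subset_einterval[OF assms]
  obtain V where V: "\<And>N x. (\<forall>i\<le>N. x i \<in> {a..b}) \<and> (\<forall>i<N. x i \<le> x (Suc i)) \<Longrightarrow>
      (\<Sum>i<N. \<bar>ln (s (x (Suc i))) - ln (s (x i))\<bar>) \<le> V"
    using s_var[OF _ sub] unfolding finite_variation_on_def by auto
  show thesis
  proof
    fix x assume x: "x \<in> {a..b}"
    then have "\<bar>ln (s x) - ln (s a)\<bar> \<le> V"
      using V[of 1 "\<lambda>i. if i = 0 then a else x"] by auto
    then have "exp (ln (s a) - V) \<le> exp (ln (s x)) \<and> exp (ln (s x)) \<le> exp (ln (s a) + V)"
      by auto
    moreover have "exp (ln (s x)) = s x"
      using s_pos[of x] x sub by auto
    ultimately show "exp (ln (s a) - V) \<le> s x \<and> s x \<le> exp (ln (s a) + V)"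
      by (simp only:)
  qed auto
qed

lemma set_integrable_inverse_s:
  assumes "a \<in> \<I>" "b \<in> \<I>"
  shows "set_integrable lborel {a..b} (\<lambda>z. 1 / s z)"
proof -
  obtain m M where m: "0 < m" "\<And>x. x \<in> {a..b} \<Longrightarrow> m \<le> s x \<and> s x \<le> M"
    using s_bounds[OF assms] by metis
  show ?thesis
  proof (rule set_integrable_bound)
    show "set_integrable lborel {a..b} (\<lambda>_. 1 / m)"
      by (intro borel_integrable_atLeastAtMost') auto
    have "(\<lambda>z. 1 / s z) \<in> borel_measurable (restrict_space borel {a..b})"
      by (intro borel_measurable_divide measurable_restrict_mono[OF s_meas]
          Icc_subset_einterval assms) auto
    then show "set_borel_measurable lborel {a..b} (\<lambda>z. 1 / s z)"
      by (simp add: set_borel_measurable_def borel_measurable_restrict_space_iff)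
    have "norm (1 / s x) \<le> norm (1 / m)" if "x \<in> {a..b}" for x
      using m(1) m(2)[OF that] by (simp add: frac_le)
    then show "AE x in lborel. x \<in> {a..b} \<longrightarrow> norm (1 / s x) \<le> norm (1 / m)"
      by auto
  qed
qed

lemma H_diff:
  assumes "x \<in> \<I>" "y \<in> \<I>" "x \<le> y"
  shows "H y - H x = (LBINT z:{x..y}. 1 / s z)"
proof -
  \<comment> \<open>The interval is enlarged to contain x0, so that additivity of the oriented
    integral applies wherever x0 lies relative to x and y.\<close>
  define a b where "a = min x0 x" and "b = max x0 y"
  have "a \<in> \<I>" "b \<in> \<I>" "a \<le> b"
    using x0 assms by (auto simp: a_def b_def min_def max_def)
  then have "set_integrable lborel (einterval a b) (\<lambda>z. 1 / s z)"
    by (intro set_integrable_subset[OF set_integrable_inverse_s[of a b]]) (auto simp: einterval_iff)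
  then have "interval_lebesgue_integrable lborel (ereal a) (ereal b) (\<lambda>z. 1 / s z)"
    using \<open>a \<le> b\<close> by (simp add: interval_lebesgue_integrable_def)
  also have "ereal a = min (ereal x0) (min (ereal x) (ereal y))"
    using assms(3) by (auto simp: a_def min_def)
  also have "ereal b = max (ereal x0) (max (ereal x) (ereal y))"
    using assms(3) by (auto simp: b_def max_def)
  finally have "H x + (LBINT z=ereal x..ereal y. 1 / s z) = H y"
    unfolding H_fun_def by (rule interval_integral_sum)
  then show ?thesis
    using interval_integral_Icc[OF assms(3)] by (metis add_diff_cancel_left')
qed

text \<open>The slope \<open>1 / M\<close> from below gives strict monotonicity and makes M a
  Lipschitz constant of the inverse; the slope \<open>1 / m\<close> from above gives
  continuity.\<close>

lemma H_bounds:
  assumes "a \<in> \<I>" "b \<in> \<I>"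
  obtains m M where "0 < m" "0 < M"
    "\<And>x y. a \<le> x \<Longrightarrow> x \<le> y \<Longrightarrow> y \<le> b \<Longrightarrow> (y - x) / M \<le> H y - H x \<and> H y - H x \<le> (y - x) / m"
proof -
  obtain m M where m: "0 < m" "0 < M" "\<And>x. x \<in> {a..b} \<Longrightarrow> m \<le> s x \<and> s x \<le> M"
    using s_bounds[OF assms] by metis
  show thesis
  proof (rule that[OF m(1,2)])
    fix x y assume xy: "a \<le> x" "x \<le> y" "y \<le> b"
    then have I: "x \<in> \<I>" "y \<in> \<I>"
      using Icc_subset_einterval[OF assms] by auto
    have const: "(LBINT z:{x..y}. 1 / k) = (y - x) / k" for k
      using xy by (simp add: set_integral_const measure_def)
    have int: "set_integrable lborel {x..y} (\<lambda>z. 1 / k)" for k :: real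
      by (intro borel_integrable_atLeastAtMost') auto
    have "(LBINT z:{x..y}. 1 / M) \<le> (LBINT z:{x..y}. 1 / s z)"
      using m xy by (intro set_integral_mono set_integrable_inverse_s I int frac_le)
        (auto intro: less_le_trans)
    moreover have "(LBINT z:{x..y}. 1 / s z) \<le> (LBINT z:{x..y}. 1 / m)"
      using m xy by (intro set_integral_mono set_integrable_inverse_s I int frac_le)
        (auto intro: less_le_trans)
    ultimately show "(y - x) / M \<le> H y - H x \<and> H y - H x \<le> (y - x) / m"
      unfolding const using xy by (simp only: H_diff[OF I])
  qed
qed

lemma H_strict_mono: "x \<in> \<I> \<Longrightarrow> y \<in> \<I> \<Longrightarrow> x < y \<Longrightarrow> H x < H y"
  using H_bounds[of x y] by (smt (verit) divide_pos_pos)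

lemma H_inj: "inj_on H \<I>"
  using H_strict_mono by (intro linorder_inj_onI) force+

lemma H_continuous:
  assumes "a \<in> \<I>" "b \<in> \<I>"
  shows "continuous_on {a..b} H"
proof -
  obtain m M where m: "0 < m"
    "\<And>x y. a \<le> x \<Longrightarrow> x \<le> y \<Longrightarrow> y \<le> b \<Longrightarrow> (y - x) / M \<le> H y - H x \<and> H y - H x \<le> (y - x) / m"
    and "0 < M"
    using H_bounds[OF assms] by metis
  have le: "\<bar>H x - H y\<bar> \<le> 1 / m * \<bar>x - y\<bar>" if "x \<in> {a..b}" "y \<in> {a..b}" "x \<le> y" for x y
  proof -
    have "0 \<le> (y - x) / M"
      using that \<open>0 < M\<close> by simp
    then show ?thesis
      using m(2)[of x y] that by (simp add: abs_if)
  qed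
  have "(1 / m)-lipschitz_on {a..b} H"
  proof (rule lipschitz_onI)
    fix x y assume "x \<in> {a..b}" "y \<in> {a..b}"
    then show "dist (H x) (H y) \<le> 1 / m * dist x y"
      using le[of x y] le[of y x] by (cases "x \<le> y") (simp_all add: dist_real_def abs_minus_commute)
  qed (use m in simp)
  then show ?thesis by (rule lipschitz_on_continuous_on)
qed

lemma H_unbounded:
  obtains a b where "a \<in> \<I>" "b \<in> \<I>" "a \<le> b" "H a \<le> - R" "R \<le> H b"
proof -
  have lr: "l < ereal x0" "ereal x0 < r"
    using x0 by (auto simp: einterval_iff)
  obtain u where u: "l < u" "\<And>y. l < y \<Longrightarrow> y < u \<Longrightarrow> H (real_of_ereal y) \<le> - R"
    using H_left lr(1) unfolding filterlim_at_bot by (auto simp: eventually_at_right)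
  obtain v where v: "v < r" "\<And>y. v < y \<Longrightarrow> y < r \<Longrightarrow> R \<le> H (real_of_ereal y)"
    using H_right lr(2) unfolding filterlim_at_top by (auto simp: eventually_at_left)
  \<comment> \<open>Choosing a below x0 and b above x0 ensures that they are ordered and that both
    lie in the interval.\<close>
  obtain a where a: "l < ereal a" "ereal a < min u (ereal x0)"
    using ereal_dense2[of l "min u (ereal x0)"] u lr by auto
  obtain b where b: "max v (ereal x0) < ereal b" "ereal b < r"
    using ereal_dense2[of "max v (ereal x0)" r] v lr by auto
  show thesis
  proof
    show "a \<in> \<I>"
      using a lr less_trans[of "ereal a" "ereal x0" r] by (auto simp: einterval_iff)
    show "b \<in> \<I>"
      using b lr less_trans[of l "ereal x0" "ereal b"] by (auto simp: einterval_iff)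
    show "a \<le> b"
      using a b by auto
    show "H a \<le> - R"
      using u(2)[of "ereal a"] a by simp
    show "R \<le> H b"
      using v(2)[of "ereal b"] b by simp
  qed
qed

lemma H_surj: "H ` \<I> = UNIV"
proof -
  have "y \<in> H ` \<I>" for y
  proof -
    obtain a b where ab: "a \<in> \<I>" "b \<in> \<I>" "a \<le> b" "H a \<le> - \<bar>y\<bar>" "\<bar>y\<bar> \<le> H b"
      using H_unbounded by blast
    obtain x where "a \<le> x" "x \<le> b" "H x = y"
      using IVT'[of H a y b] ab H_continuous[OF ab(1,2)] by (smt (verit))
    then show ?thesis
      using Icc_subset_einterval[OF ab(1,2)] by auto
  qed
  then show ?thesis by auto
qed

lemma Theta_in: "\<Theta> y \<in> \<I>"
  unfolding Theta_def by (rule the_inv_into_into[OF H_inj]) (auto simp: H_surj)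

lemma H_Theta: "H (\<Theta> y) = y"
  unfolding Theta_def by (rule f_the_inv_into_f[OF H_inj]) (simp add: H_surj)

text \<open>Two things are needed of a bounded range of arguments: its image stays in a compact part
  of the interval, where a Lipschitz constant of b is available, and \<open>\<Theta>\<close> is
  Lipschitz on it.\<close>

lemma Theta_bounds:
  obtains a b K where "a \<in> \<I>" "b \<in> \<I>" "0 < K" "\<And>y. \<bar>y\<bar> \<le> R \<Longrightarrow> \<Theta> y \<in> {a..b}"
    "\<And>y z. \<bar>y\<bar> \<le> R \<Longrightarrow> \<bar>z\<bar> \<le> R \<Longrightarrow> \<bar>\<Theta> y - \<Theta> z\<bar> \<le> K * \<bar>y - z\<bar>"
proof -
  obtain a b where ab: "a \<in> \<I>" "b \<in> \<I>" "a \<le> b" "H a \<le> - R" "R \<le> H b"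
    using H_unbounded by blast
  obtain m M where M: "0 < M"
    "\<And>x y. a \<le> x \<Longrightarrow> x \<le> y \<Longrightarrow> y \<le> b \<Longrightarrow> (y - x) / M \<le> H y - H x \<and> H y - H x \<le> (y - x) / m"
    using H_bounds[OF ab(1,2)] by metis
  have in_ab: "\<Theta> y \<in> {a..b}" if "\<bar>y\<bar> \<le> R" for y
    using H_strict_mono[OF Theta_in ab(1), of y] H_strict_mono[OF ab(2) Theta_in, of y] ab that
    by (auto simp: H_Theta not_less[symmetric])
  have le: "\<bar>\<Theta> y - \<Theta> z\<bar> \<le> M * \<bar>y - z\<bar>" if "\<bar>y\<bar> \<le> R" "\<bar>z\<bar> \<le> R" "\<Theta> y \<le> \<Theta> z" for y z
  proof -
    have "(\<Theta> z - \<Theta> y) / M \<le> z - y"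
      using M(2)[of "\<Theta> y" "\<Theta> z"] in_ab[of y] in_ab[of z] that by (auto simp: H_Theta)
    then have "\<Theta> z - \<Theta> y \<le> M * (z - y)"
      using M(1) by (simp add: divide_le_eq mult.commute)
    also have "\<dots> \<le> M * \<bar>y - z\<bar>"
      using M(1) by (intro mult_left_mono) auto
    finally show ?thesis
      using that by simp
  qed
  show thesis
  proof (rule that[OF ab(1,2) M(1) in_ab])
    fix y z assume "\<bar>y\<bar> \<le> R" "\<bar>z\<bar> \<le> R"
    then show "\<bar>\<Theta> y - \<Theta> z\<bar> \<le> M * \<bar>y - z\<bar>"
      using le[of y z] le[of z y] by (cases "\<Theta> y \<le> \<Theta> z") (auto simp: abs_minus_commute)
  qed
qed

lemma Theta_continuous: "continuous_on UNIV \<Theta>"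
proof -
  have "isCont \<Theta> y" for y
  proof -
    obtain K where K: "0 < K"
      "\<And>u v. \<bar>u\<bar> \<le> \<bar>y\<bar> + 1 \<Longrightarrow> \<bar>v\<bar> \<le> \<bar>y\<bar> + 1 \<Longrightarrow> \<bar>\<Theta> u - \<Theta> v\<bar> \<le> K * \<bar>u - v\<bar>"
      using Theta_bounds[of "\<bar>y\<bar> + 1"] by metis
    have "K-lipschitz_on (ball y 1) \<Theta>"
    proof (rule lipschitz_onI)
      fix u v assume "u \<in> ball y 1" "v \<in> ball y 1"
      then show "dist (\<Theta> u) (\<Theta> v) \<le> K * dist u v"
        unfolding dist_real_def by (intro K(2)) (auto simp: dist_real_def)
    qed (use K in simp)
    then show ?thesis
      using lipschitz_on_continuous_on[of K "ball y 1" \<Theta>]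
      by (simp add: continuous_on_eq_continuous_at)
  qed
  then show ?thesis
    by (simp add: continuous_at_imp_continuous_on)
qed

end

section \<open>The input-output map\<close>

text \<open>Oriented integrals run over the open interval, whose endpoints form a null set.\<close>

lemma solves_integral_eq_iff:
  "solves_integral_eq b \<Theta> \<omega> \<Gamma> \<longleftrightarrow> \<Gamma> \<in> extensional {0..} \<and>
     (\<forall>T\<ge>0. set_integrable lborel {0..T} (\<lambda>t. b t (\<omega> t) (\<Theta> (\<Gamma> t + \<omega> t))) \<and>
        \<Gamma> T = (LBINT t:{0..T}. b t (\<omega> t) (\<Theta> (\<Gamma> t + \<omega> t))))"
proof -
  have "interval_lebesgue_integrable lborel 0 (ereal T) f \<longleftrightarrow> set_integrable lborel {0..T} f"
    if "0 \<le> T" for T and f :: "real \<Rightarrow> real"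
  proof -
    have "set_integrable lborel {0<..<T} f \<longleftrightarrow> set_integrable lborel {0..T} f"
      by (rule set_integrable_discrete_difference[where X = "{0, T}"]) auto
    then show ?thesis
      using that by (simp add: interval_lebesgue_integrable_def zero_ereal_def)
  qed
  moreover have "(LBINT t=0..ereal T. f t) = (LBINT t:{0..T}. f t)" if "0 \<le> T" for T and f :: "real \<Rightarrow> real"
    using interval_integral_Icc[OF that] by (simp add: zero_ereal_def)
  ultimately show ?thesis
    unfolding solves_integral_eq_def by auto
qed

text \<open>Only times in [0, T] enter the equation, so agreement of the fields for nonnegative
  times is enough. Restriction selects the extensional representative, which turns uniqueness into
  equality of functions.\<close>

lemma (in integral_equation) solves_integral_eq_iff_solution:
  assumes field: "\<And>t w y. 0 \<le> t \<Longrightarrow> b t w (\<Theta> y) = c t w y" and \<omega>: "\<omega> \<in> cpaths UNIV"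
  shows "solves_integral_eq b \<Theta> \<omega> \<Gamma> \<longleftrightarrow> \<Gamma> = restrict (solution \<omega>) {0..}"
proof -
  have cont_\<omega>: "continuous_on {0..} \<omega>"
    using \<omega> by (simp add: cpaths_def)
  have int_cong: "set_integrable lborel {0..T} (\<lambda>t. b t (\<omega> t) (\<Theta> (\<Gamma> t + \<omega> t))) \<longleftrightarrow>
      set_integrable lborel {0..T} (\<lambda>t. c t (\<omega> t) (\<Gamma> t + \<omega> t))" for T \<Gamma>
    by (rule set_integrable_cong) (auto simp: field)
  have eq_cong: "(LBINT t:{0..T}. b t (\<omega> t) (\<Theta> (\<Gamma> t + \<omega> t))) =
      (LBINT t:{0..T}. c t (\<omega> t) (\<Gamma> t + \<omega> t))" for T \<Gamma>
    by (rule set_lebesgue_integral_cong) (auto simp: field)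
  let ?S = "restrict (solution \<omega>) {0..}"
  have "set_integrable lborel {0..T} (\<lambda>t. c t (\<omega> t) (?S t + \<omega> t)) \<longleftrightarrow>
      set_integrable lborel {0..T} (\<lambda>t. c t (\<omega> t) (solution \<omega> t + \<omega> t))" for T
    by (rule set_integrable_cong) auto
  moreover have "(LBINT t:{0..T}. c t (\<omega> t) (?S t + \<omega> t)) =
      (LBINT t:{0..T}. c t (\<omega> t) (solution \<omega> t + \<omega> t))" for T
    by (rule set_lebesgue_integral_cong) auto
  moreover have "set_integrable lborel {0..T} (\<lambda>t. c t (\<omega> t) (solution \<omega> t + \<omega> t))" for T
    by (intro set_integrable_field continuous_on_add continuous_on_solution cont_\<omega>)
  ultimately have "solves_integral_eq b \<Theta> \<omega> ?S"
    unfolding solves_integral_eq_iff int_cong eq_cong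
    using solution_eq[OF cont_\<omega>] by simp
  moreover have "\<Gamma> = ?S" if "solves_integral_eq b \<Theta> \<omega> \<Gamma>"
  proof (rule extensionalityI)
    fix T :: real assume "T \<in> {0..}"
    then show "\<Gamma> T = ?S T"
      using that solution_unique[OF cont_\<omega>, of \<Gamma> T]
      unfolding solves_integral_eq_iff int_cong eq_cong by simp
  qed (use that in \<open>auto simp: solves_integral_eq_def\<close>)
  ultimately show ?thesis by blast
qed

section \<open>Uniform convergence on compact sets and continuity of path maps\<close>

lemma uniform_limit_iff_SUP:
  fixes f :: "real \<Rightarrow> real"
  assumes f: "continuous_on {0..} f" and g: "\<And>k::nat. continuous_on {0..} (g k)"
    and T: "0 \<le> T"
  shows "(\<lambda>k. SUP t\<in>{0..T}. \<bar>f t - g k t\<bar>) \<longlonglongrightarrow> 0 \<longleftrightarrow> uniform_limit {0..T} g f sequentially"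
proof
  have bdd: "bdd_above ((\<lambda>t. \<bar>f t - g k t\<bar>) ` {0..T})" for k
    by (intro bounded_imp_bdd_above compact_imp_bounded compact_continuous_image continuous_intros
        continuous_on_subset[OF f] continuous_on_subset[OF g]) auto
  have upper: "\<bar>f t - g k t\<bar> \<le> (SUP t\<in>{0..T}. \<bar>f t - g k t\<bar>)" if "t \<in> {0..T}" for t k
    using that by (rule cSUP_upper[OF _ bdd])
  {
    assume lim: "(\<lambda>k. SUP t\<in>{0..T}. \<bar>f t - g k t\<bar>) \<longlonglongrightarrow> 0"
    show "uniform_limit {0..T} g f sequentially"
    proof (rule uniform_limitI)
      fix e :: real assume "0 < e"
      with lim have "\<forall>\<^sub>F k in sequentially. (SUP t\<in>{0..T}. \<bar>f t - g k t\<bar>) < e"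
        by (rule order_tendstoD)
      then show "\<forall>\<^sub>F k in sequentially. \<forall>t\<in>{0..T}. dist (g k t) (f t) < e"
        by eventually_elim
          (use upper in \<open>fastforce simp: dist_real_def abs_minus_commute intro: le_less_trans\<close>)
    qed
  }
  assume lim: "uniform_limit {0..T} g f sequentially"
  show "(\<lambda>k. SUP t\<in>{0..T}. \<bar>f t - g k t\<bar>) \<longlonglongrightarrow> 0"
  proof (rule tendstoI)
    fix e :: real assume "0 < e"
    \<comment> \<open>Strict pointwise bounds give only a weak bound on the supremum, hence
      \<open>e / 2\<close>.\<close>
    then have "\<forall>\<^sub>F k in sequentially. \<forall>t\<in>{0..T}. dist (g k t) (f t) < e / 2"
      by (intro uniform_limitD[OF lim]) simp
    then show "\<forall>\<^sub>F k in sequentially. dist (SUP t\<in>{0..T}. \<bar>f t - g k t\<bar>) 0 < e"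
    proof eventually_elim
      case (elim k)
      have "(SUP t\<in>{0..T}. \<bar>f t - g k t\<bar>) \<le> e / 2"
        using elim T by (intro cSUP_least) (auto simp: dist_real_def abs_minus_commute intro: less_imp_le)
      moreover have "0 \<le> (SUP t\<in>{0..T}. \<bar>f t - g k t\<bar>)"
        using upper[of 0 k] T by auto
      ultimately show ?case
        using \<open>0 < e\<close> by simp
    qed
  qed
qed

text \<open>Each path has a countable neighbourhood base, so sequential continuity is enough;
  preimages need to be tested only for the generating sets.\<close>

lemma continuous_map_ucc_topology:
  assumes X: "\<And>\<omega>. \<omega> \<in> cpaths A \<Longrightarrow> X \<omega> \<in> cpaths S"
    and seq: "\<And>\<omega> \<omega>k. \<omega> \<in> cpaths A \<Longrightarrow> (\<And>k::nat. \<omega>k k \<in> cpaths A) \<Longrightarrow>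
      (\<And>n::nat. uniform_limit {0..real n} \<omega>k \<omega> sequentially) \<Longrightarrow>
      (\<And>n::nat. uniform_limit {0..real n} (\<lambda>k. X (\<omega>k k)) (X \<omega>) sequentially)"
  shows "continuous_map (ucc_topology A) (ucc_topology S) X"
  unfolding ucc_topology_def[of S] continuous_on_generated_topo_iff
proof (intro conjI allI impI)
  show "X ` topspace (ucc_topology A) \<subseteq> \<Union> {{g \<in> cpaths S. \<forall>t\<in>K. dist (f t) (g t) < e} | f K e.
        f \<in> cpaths S \<and> compact K \<and> K \<subseteq> {0..} \<and> 0 < e}"
    unfolding topspace_ucc_topology
      topspace_ucc_topology[of S, unfolded ucc_topology_def topology_generated_by_topspace]
    using X by (rule image_subsetI)
  fix U assume "U \<in> {{g \<in> cpaths S. \<forall>t\<in>K. dist (f t) (g t) < e} | f K e.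
        f \<in> cpaths S \<and> compact K \<and> K \<subseteq> {0..} \<and> 0 < e}"
  then obtain f K e where U: "U = {g \<in> cpaths S. \<forall>t\<in>K. dist (f t) (g t) < e}"
    and f: "f \<in> cpaths S" and K: "compact K" "K \<subseteq> {0..}" and e: "0 < e"
    by blast
  show "openin (ucc_topology A) (X -` U \<inter> topspace (ucc_topology A))"
    unfolding topspace_ucc_topology
  proof (subst openin_subopen, intro ballI)
    fix \<omega> assume "\<omega> \<in> X -` U \<inter> cpaths A"
    then have \<omega>: "\<omega> \<in> cpaths A" and XU: "\<forall>t\<in>K. dist (f t) (X \<omega> t) < e"
      by (auto simp: U)
    obtain n :: nat where n: "K \<subseteq> {0..real n}"
    proof -
      obtain M where "\<And>t. t \<in> K \<Longrightarrow> \<bar>t\<bar> \<le> M"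
        using compact_imp_bounded[OF K(1)] unfolding bounded_real by auto
      moreover obtain n :: nat where "M \<le> real n"
        using real_arch_simple by blast
      ultimately show thesis
        using K(2) by (intro that[of n]) fastforce
    qed
    \<comment> \<open>By compactness the distance attains its maximum on K, which is below e; d is
      the remaining margin.\<close>
    obtain d where d: "0 < d" "\<And>t. t \<in> K \<Longrightarrow> dist (f t) (X \<omega> t) + d \<le> e"
    proof (cases "K = {}")
      case False
      have "continuous_on K (\<lambda>t. dist (f t) (X \<omega> t))"
        using f X[OF \<omega>] K(2) by (intro continuous_on_dist) (auto simp: cpaths_def intro: continuous_on_subset)
      then obtain u where u: "u \<in> K" "\<And>t. t \<in> K \<Longrightarrow> dist (f t) (X \<omega> t) \<le> dist (f u) (X \<omega> u)"
        using continuous_attains_sup[OF K(1) False] by blast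
      show thesis
        using u XU by (intro that[of "e - dist (f u) (X \<omega> u)"]) auto
    qed (use that[of 1] in auto)
    \<comment> \<open>A single index governs both the length of the time interval and the
      precision.\<close>
    define V where "V k = {\<omega>' \<in> cpaths A. \<forall>t\<in>{0..real k}. dist (\<omega> t) (\<omega>' t) < 1 / real (Suc k)}" for k
    have V: "openin (ucc_topology A) (V k)" "\<omega> \<in> V k" for k
    proof -
      show "openin (ucc_topology A) (V k)"
        unfolding ucc_topology_def V_def using \<omega>
        by (intro topology_generated_by_Basis CollectI exI[of _ \<omega>] exI[of _ "{0..real k}"]
            exI[of _ "1 / real (Suc k)"]) auto
    qed (use \<omega> in \<open>simp add: V_def\<close>)
    \<comment> \<open>Otherwise a bad path could be picked from every \<open>V k\<close>; these
      paths converge to \<omega> locally uniformly while their images stay away from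
      \<open>X \<omega>\<close>.\<close>
    have "\<exists>k. \<forall>\<omega>'\<in>V k. \<forall>t\<in>{0..real n}. dist (X \<omega>' t) (X \<omega> t) < d"
    proof (rule ccontr)
      assume "\<not> ?thesis"
      then have "\<forall>k. \<exists>\<omega>'. \<omega>' \<in> V k \<and> \<not> (\<forall>t\<in>{0..real n}. dist (X \<omega>' t) (X \<omega> t) < d)"
        by blast
      then obtain \<omega>k where \<omega>k: "\<And>k. \<omega>k k \<in> V k"
        "\<And>k. \<not> (\<forall>t\<in>{0..real n}. dist (X (\<omega>k k) t) (X \<omega> t) < d)"
        by metis
      have "uniform_limit {0..real m} \<omega>k \<omega> sequentially" for m
      proof (rule uniform_limitI)
        fix \<epsilon> :: real assume "0 < \<epsilon>"
        then have "\<forall>\<^sub>F k in sequentially. 1 / real (Suc k) < \<epsilon>"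
          using order_tendstoD(2)[OF LIMSEQ_inverse_real_of_nat] by (simp add: inverse_eq_divide)
        then show "\<forall>\<^sub>F k in sequentially. \<forall>t\<in>{0..real m}. dist (\<omega>k k t) (\<omega> t) < \<epsilon>"
          using eventually_ge_at_top[of m]
        proof eventually_elim
          case (elim k)
          show ?case
          proof
            fix t assume "t \<in> {0..real m}"
            then have "dist (\<omega> t) (\<omega>k k t) < 1 / real (Suc k)"
              using \<omega>k(1)[of k] elim(2) unfolding V_def by auto
            then show "dist (\<omega>k k t) (\<omega> t) < \<epsilon>"
              using elim(1) by (simp only: dist_commute)
          qed
        qed
      qed
      then have "uniform_limit {0..real n} (\<lambda>k. X (\<omega>k k)) (X \<omega>) sequentially"
        using \<omega> \<omega>k(1) by (intro seq) (auto simp: V_def)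
      then have "\<forall>\<^sub>F k in sequentially. \<forall>t\<in>{0..real n}. dist (X (\<omega>k k) t) (X \<omega> t) < d"
        using d(1) by (rule uniform_limitD)
      then show False
        using \<omega>k(2) by simp
    qed
    then obtain k where k: "\<And>\<omega>' t. \<omega>' \<in> V k \<Longrightarrow> t \<in> {0..real n} \<Longrightarrow> dist (X \<omega>' t) (X \<omega> t) < d"
      by blast
    have "V k \<subseteq> X -` U \<inter> cpaths A"
    proof
      fix \<omega>' assume \<omega>': "\<omega>' \<in> V k"
      then have "\<omega>' \<in> cpaths A" by (simp add: V_def)
      moreover have "dist (f t) (X \<omega>' t) < e" if "t \<in> K" for t
        using k[OF \<omega>', of t] d(2)[OF that] n that dist_triangle[of "f t" "X \<omega>' t" "X \<omega> t"]
        by (auto simp: dist_commute)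
      ultimately show "\<omega>' \<in> X -` U \<inter> cpaths A"
        using X by (simp add: U)
    qed
    then show "\<exists>T. openin (ucc_topology A) T \<and> \<omega> \<in> T \<and> T \<subseteq> X -` U \<inter> cpaths A"
      using V by blast
  qed
qed

theorem theorem6p1:
  fixes l r :: ereal and x0 :: real and ls rs :: "nat \<Rightarrow> real"
    and s :: "real \<Rightarrow> real" and b :: "real \<Rightarrow> real \<Rightarrow> real \<Rightarrow> real" and L :: "nat \<Rightarrow> real"
  assumes x0: "x0 \<in> einterval l r"
    and ls: "\<And>n. l < ereal (ls (Suc n)) \<and> ls (Suc n) < ls n \<and> ls n < x0"
    and rs: "\<And>n. x0 < rs n \<and> rs n < rs (Suc n) \<and> ereal (rs (Suc n)) < r"
    and ls_lim: "(\<lambda>n. ereal (ls n)) \<longlonglongrightarrow> l"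
    and rs_lim: "(\<lambda>n. ereal (rs n)) \<longlonglongrightarrow> r"
    and s_pos: "\<And>x. x \<in> einterval l r \<Longrightarrow> 0 < s x"
    and s_meas: "s \<in> borel_measurable (restrict_space borel (einterval l r))"
    and s_left_cont: "\<And>x. x \<in> einterval l r \<Longrightarrow> continuous (at_left x) (\<lambda>z. ln (s z))"
    and s_var: "\<And>K. compact K \<Longrightarrow> K \<subseteq> einterval l r \<Longrightarrow> finite_variation_on K (\<lambda>z. ln (s z))"
    and b_bounded: "\<exists>B. \<forall>t\<ge>0. \<forall>w. \<forall>\<xi>\<in>einterval l r. \<bar>b t w \<xi>\<bar> \<le> B"
    and b_meas: "(\<lambda>(t, w, \<xi>). b t w \<xi>)
      \<in> borel_measurable (restrict_space borel ({0..} \<times> UNIV \<times> einterval l r))"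
    and H_left: "filterlim (H_fun s x0 \<circ> real_of_ereal) at_bot (at_right l)"
    and H_right: "filterlim (H_fun s x0 \<circ> real_of_ereal) at_top (at_left r)"
    and b_cont: "\<And>t \<xi>. 0 \<le> t \<Longrightarrow> \<xi> \<in> einterval l r \<Longrightarrow> continuous_on UNIV (\<lambda>w. b t w \<xi>)"
    and b_lip: "\<And>n t w \<xi>1 \<xi>2. t \<in> {0..real n} \<Longrightarrow> w \<in> {-real n..real n} \<Longrightarrow>
      \<xi>1 \<in> {ls n<..<rs n} \<Longrightarrow> \<xi>2 \<in> {ls n<..<rs n} \<Longrightarrow>
      \<bar>b t w \<xi>1 - b t w \<xi>2\<bar> \<le> L n * \<bar>\<xi>1 - \<xi>2\<bar>"
  shows "(\<forall>\<omega>\<in>cpaths UNIV. \<exists>!\<Gamma>. solves_integral_eq b (Theta l r s x0) \<omega> \<Gamma>) \<and>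
    progressively_measurable coord_filtration (Gamma_sol b (Theta l r s x0)) \<and>
    (\<forall>\<omega>\<in>cpaths UNIV. \<forall>\<omega>k. (\<forall>k::nat. \<omega>k k \<in> cpaths UNIV) \<longrightarrow>
      (\<forall>n::nat. (\<lambda>k. SUP t\<in>{0..real n}. \<bar>\<omega> t - \<omega>k k t\<bar>) \<longlonglongrightarrow> 0) \<longrightarrow>
      (\<forall>n::nat. (\<lambda>k. SUP t\<in>{0..real n}.
         \<bar>input_output b (Theta l r s x0) \<omega> t - input_output b (Theta l r s x0) (\<omega>k k) t\<bar>)
         \<longlonglongrightarrow> 0)) \<and>
    continuous_map (ucc_topology UNIV) (ucc_topology (einterval l r))
      (input_output b (Theta l r s x0))"
proof -
  interpret barrow_osgood l r x0 s
    by unfold_locales fact+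
  \<comment> \<open>Nothing is known about b at negative times, whereas the locale speaks of all
    times; zero there preserves every requirement.\<close>
  define c where "c t w y = (if 0 \<le> t then b t w (\<Theta> y) else 0)" for t w y
  obtain B0 where B0: "\<And>t w \<xi>. 0 \<le> t \<Longrightarrow> \<xi> \<in> \<I> \<Longrightarrow> \<bar>b t w \<xi>\<bar> \<le> B0"
    using b_bounded by blast
  interpret integral_equation c "\<bar>B0\<bar>"
  proof
    \<comment> \<open>b is measurable only on its domain. Extended by zero off this Borel set it
      becomes a Borel function of three real variables, which can be composed with
      \<open>\<Theta>\<close> in the last one.\<close>
    have "{0..} \<times> UNIV \<times> \<I> \<in> sets (borel :: (real \<times> real \<times> real) measure)"
      by (intro borel_Times) auto
    then have ext: "(\<lambda>p. indicator ({0..} \<times> UNIV \<times> \<I>) p *\<^sub>R (case p of (t, w, \<xi>) \<Rightarrow> b t w \<xi>))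
        \<in> borel_measurable borel"
      using b_meas by (subst (asm) borel_measurable_restrict_space_iff) auto
    have [measurable]: "\<Theta> \<in> borel_measurable borel"
      by (rule borel_measurable_continuous_onI[OF Theta_continuous])
    have "(\<lambda>(t :: real, w :: real, y). (t, w, \<Theta> y)) \<in> borel \<Otimes>\<^sub>M borel \<Otimes>\<^sub>M borel \<rightarrow>\<^sub>M borel \<Otimes>\<^sub>M borel \<Otimes>\<^sub>M borel"
      by measurable
    then have "(\<lambda>(t :: real, w :: real, y). (t, w, \<Theta> y)) \<in> borel \<rightarrow>\<^sub>M borel"
      by (simp add: borel_prod)
    from measurable_compose[OF this ext]
    show "(\<lambda>(t, w, y). c t w y) \<in> borel_measurable borel"
      by (rule measurable_cong[THEN iffD1, rotated]) (auto simp: c_def indicator_def Theta_in split: if_splits)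
    show "\<bar>c t w y\<bar> \<le> \<bar>B0\<bar>" for t w y
      using B0[OF _ Theta_in, of t w y] by (auto simp: c_def)
    show "continuous_on UNIV (\<lambda>w. c t w y)" for t y
      using b_cont[OF _ Theta_in, of t y] by (cases "0 \<le> t") (simp_all add: c_def)
    fix n :: nat
    obtain a a' K where aK: "a \<in> \<I>" "a' \<in> \<I>" "0 < K" "\<And>y. \<bar>y\<bar> \<le> real n \<Longrightarrow> \<Theta> y \<in> {a..a'}"
      "\<And>y z. \<bar>y\<bar> \<le> real n \<Longrightarrow> \<bar>z\<bar> \<le> real n \<Longrightarrow> \<bar>\<Theta> y - \<Theta> z\<bar> \<le> K * \<bar>y - z\<bar>"
      using Theta_bounds[of "real n"] by metis
    \<comment> \<open>The index N has to serve twice: it exceeds n, to cover the times and path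
      values, and its interval contains the compact image under \<open>\<Theta>\<close> of the
      states bounded by n.\<close>
    have "\<forall>\<^sub>F N in sequentially. ereal (ls N) < ereal a" "\<forall>\<^sub>F N in sequentially. ereal a' < ereal (rs N)"
      using order_tendstoD(2)[OF ls_lim, of "ereal a"] order_tendstoD(1)[OF rs_lim, of "ereal a'"] aK(1,2)
      by (simp_all add: einterval_iff)
    then have "\<forall>\<^sub>F N in sequentially. n \<le> N \<and> ls N < a \<and> a' < rs N"
      using eventually_ge_at_top[of n] by eventually_elim simp
    then obtain N where N: "n \<le> N" "ls N < a" "a' < rs N"
      unfolding eventually_sequentially by blast
    show "\<exists>K. \<forall>t\<in>{0..real n}. \<forall>w\<in>{-real n..real n}. \<forall>y1\<in>{-real n..real n}. \<forall>y2\<in>{-real n..real n}.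
        \<bar>c t w y1 - c t w y2\<bar> \<le> K * \<bar>y1 - y2\<bar>"
    proof (intro exI[of _ "\<bar>L N\<bar> * K"] ballI)
      fix t w y1 y2
      assume *: "t \<in> {0..real n}" "w \<in> {-real n..real n}" "y1 \<in> {-real n..real n}" "y2 \<in> {-real n..real n}"
      then have y: "\<bar>y1\<bar> \<le> real n" "\<bar>y2\<bar> \<le> real n"
        by auto
      have "\<bar>b t w (\<Theta> y1) - b t w (\<Theta> y2)\<bar> \<le> L N * \<bar>\<Theta> y1 - \<Theta> y2\<bar>"
        using * N aK(4)[OF y(1)] aK(4)[OF y(2)] by (intro b_lip) auto
      also have "\<dots> \<le> \<bar>L N\<bar> * (K * \<bar>y1 - y2\<bar>)"
        using aK(5)[OF y] by (intro mult_mono) auto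
      finally show "\<bar>c t w y1 - c t w y2\<bar> \<le> \<bar>L N\<bar> * K * \<bar>y1 - y2\<bar>"
        using * by (simp add: c_def mult.assoc)
    qed
  qed
  have solves: "solves_integral_eq b \<Theta> \<omega> \<Gamma> \<longleftrightarrow> \<Gamma> = restrict (solution \<omega>) {0..}"
    if "\<omega> \<in> cpaths UNIV" for \<omega> \<Gamma>
    using that by (intro solves_integral_eq_iff_solution) (simp add: c_def)
  have Gamma: "Gamma_sol b \<Theta> \<omega> = restrict (solution \<omega>) {0..}" if "\<omega> \<in> cpaths UNIV" for \<omega>
    unfolding Gamma_sol_def by (rule the_equality) (simp_all add: solves[OF that])
  have unique: "\<forall>\<omega>\<in>cpaths UNIV. \<exists>!\<Gamma>. solves_integral_eq b \<Theta> \<omega> \<Gamma>"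
    using solves by simp
  have prog: "progressively_measurable coord_filtration (Gamma_sol b \<Theta>)"
    unfolding progressively_measurable_def
  proof (intro allI impI)
    fix t :: real assume "0 \<le> t"
    then have "(\<lambda>(s, \<omega>). solution \<omega> s) \<in> borel_measurable (restrict_space borel {0..t} \<Otimes>\<^sub>M coord_filtration t)"
      by (rule solution_measurable)
    then show "(\<lambda>(s, \<omega>). Gamma_sol b \<Theta> \<omega> s)
        \<in> borel_measurable (restrict_space borel {0..t} \<Otimes>\<^sub>M coord_filtration t)"
      by (rule measurable_cong[THEN iffD1, rotated])
         (auto simp: space_pair_measure space_restrict_space space_coord_filtration Gamma)
  qed
  have io: "input_output b \<Theta> \<omega> t = \<Theta> (solution \<omega> t + \<omega> t)" if "\<omega> \<in> cpaths UNIV" "0 \<le> t" for \<omega> t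
    using that by (simp add: input_output_def Gamma)
  have cont: "continuous_on {0..} \<omega>" if "\<omega> \<in> cpaths S" for \<omega> S
    using that by (simp add: cpaths_def)
  have io_cpaths: "input_output b \<Theta> \<omega> \<in> cpaths \<I>" if "\<omega> \<in> cpaths UNIV" for \<omega>
  proof -
    have "continuous_on {0..} (\<lambda>t. \<Theta> (solution \<omega> t + \<omega> t))"
      using cont[OF that] by (intro continuous_on_compose2[OF Theta_continuous] continuous_on_add
          continuous_on_solution) auto
    then have "continuous_on {0..} (input_output b \<Theta> \<omega>)"
      by (rule continuous_on_eq) (simp add: io that)
    moreover have "input_output b \<Theta> \<omega> \<in> {0..} \<rightarrow>\<^sub>E \<I>"
      by (auto simp: input_output_def Theta_in)
    ultimately show ?thesis
      by (simp add: cpaths_def)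
  qed
  have stable: "uniform_limit {0..T} (\<lambda>k. input_output b \<Theta> (\<omega>k k)) (input_output b \<Theta> \<omega>) sequentially"
    if \<omega>: "\<omega> \<in> cpaths UNIV" "\<And>k. \<omega>k k \<in> cpaths UNIV"
      and lim: "uniform_limit {0..T} \<omega>k \<omega> sequentially" and T: "0 \<le> T" for \<omega> \<omega>k T
  proof (rule uniform_limitI)
    fix e :: real assume e: "0 < e"
    obtain M where M: "0 \<le> M" "\<And>t. t \<in> {0..T} \<Longrightarrow> \<bar>solution \<omega> t + \<omega> t\<bar> \<le> M"
      using continuous_on_bounded_abs[OF continuous_on_add[OF continuous_on_solution cont],
          OF cont, OF \<omega>(1,1)] by blast
    \<comment> \<open>The solution and the path may each move by at most d, and d is at most 1, so
      the perturbed argument stays within M + 2.\<close>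
    obtain K where K: "0 < K" "\<And>y z. \<bar>y\<bar> \<le> M + 2 \<Longrightarrow> \<bar>z\<bar> \<le> M + 2 \<Longrightarrow> \<bar>\<Theta> y - \<Theta> z\<bar> \<le> K * \<bar>y - z\<bar>"
      using Theta_bounds[of "M + 2"] by metis
    define d where "d = min 1 (e / (4 * K))"
    have d: "0 < d" "d \<le> 1" "K * (2 * d) < e"
      using K(1) e by (auto simp: d_def min_def field_simps)
    have "\<forall>\<^sub>F k in sequentially. \<forall>t\<in>{0..T}. dist (\<omega>k k t) (\<omega> t) < d"
      using lim d(1) by (rule uniform_limitD)
    moreover have "\<forall>\<^sub>F k in sequentially. \<forall>t\<in>{0..T}. dist (solution (\<omega>k k) t) (solution \<omega> t) < d"
      using solution_stable[OF cont cont lim T, OF \<omega>] d(1) by (rule uniform_limitD)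
    ultimately show "\<forall>\<^sub>F k in sequentially. \<forall>t\<in>{0..T}.
        dist (input_output b \<Theta> (\<omega>k k) t) (input_output b \<Theta> \<omega> t) < e"
    proof eventually_elim
      case (elim k)
      show ?case
      proof
        fix t assume t: "t \<in> {0..T}"
        have close: "\<bar>(solution (\<omega>k k) t + \<omega>k k t) - (solution \<omega> t + \<omega> t)\<bar> \<le> 2 * d"
          using elim[rule_format, OF t] unfolding dist_real_def by linarith
        have "\<bar>\<Theta> (solution (\<omega>k k) t + \<omega>k k t) - \<Theta> (solution \<omega> t + \<omega> t)\<bar>
          \<le> K * \<bar>(solution (\<omega>k k) t + \<omega>k k t) - (solution \<omega> t + \<omega> t)\<bar>"
          using M(2)[OF t] close d(2) by (intro K(2)) linarith+
        also have "\<dots> \<le> K * (2 * d)"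
          using close K(1) by (intro mult_left_mono) auto
        finally show "dist (input_output b \<Theta> (\<omega>k k) t) (input_output b \<Theta> \<omega> t) < e"
          using d(3) t \<omega> by (simp add: io dist_real_def)
      qed
    qed
  qed
  have "(\<lambda>k. SUP t\<in>{0..real n}. \<bar>input_output b \<Theta> \<omega> t - input_output b \<Theta> (\<omega>k k) t\<bar>) \<longlonglongrightarrow> 0"
    if "\<omega> \<in> cpaths UNIV" "\<forall>k. \<omega>k k \<in> cpaths UNIV"
      "\<forall>n::nat. (\<lambda>k. SUP t\<in>{0..real n}. \<bar>\<omega> t - \<omega>k k t\<bar>) \<longlonglongrightarrow> 0" for \<omega> \<omega>k and n :: nat
  proof -
    have "uniform_limit {0..real n} \<omega>k \<omega> sequentially"
      using that by (subst uniform_limit_iff_SUP[symmetric]) (auto intro: cont)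
    then show ?thesis
      using that by (subst uniform_limit_iff_SUP) (auto intro!: stable cont io_cpaths)
  qed
  moreover have "continuous_map (ucc_topology UNIV) (ucc_topology \<I>) (input_output b \<Theta>)"
    by (rule continuous_map_ucc_topology) (auto intro: io_cpaths stable)
  ultimately show ?thesis
    using unique prog by blast
qed

end
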